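(* Suppose that there exists a set of sensors, without loss of generality $S_c:=\{p^{t+1},\dots,p^n\}$, so that the distances $\|p^i-p^j\|$ are known for all $t+1\le i,j\le n$; i.e. the graph of the partial Euclidean distance matrix has two cliques, one corresponding to the set of known anchors and the other to the set of sensors $S_c$. Let $P$, $\bar Y$ be partitioned, according to the index blocks $\{1,\dots,t\}$, $\{t+1,\dots,n\}$, $\{n+1,\dots,n+m\}$, as $$P=\begin{pmatrix}P_1\\ P_2\\ P_3\end{pmatrix}=\begin{pmatrix}X\\ A\end{pmatrix},\qquad \bar Y=\begin{pmatrix}\bar Y_{11}&\bar Y_{21}^T&\bar Y_{31}^T\\ \bar Y_{21}&\bar Y_{22}&\bar Y_{32}^T\\ \bar Y_{31}&\bar Y_{32}&\bar Y_{33}\end{pmatrix}=PP^T,$$ where $P_i=A_i$, $i=2,3$, $A_3=A$ corresponds to the known anchors, $P_2=A_2$ corresponds to the clique of sensors $S_c$, and $X=\begin{pmatrix}P_1\\ P_2\end{pmatrix}$ corresponds to all the sensors. Let the Euclidean distance matrix $E=\mathcal{K}(\bar Y)$ be correspondingly blocked, $$E=\begin{pmatrix}E_1&\cdot&\cdot\\ \cdot&E_2&\cdot\\ \cdot&\cdot&E_3\end{pmatrix},$$ so that $E_3=\mathcal{K}(AA^T)$ are the anchor-anchor squared distances and $E_2=\mathcal{K}(P_2P_2^T)$ are the squared distances between the sensors in $S_c$. Let $B=\mathcal{K}^\dagger(E_2)$. Then the following hold. 1. $Be=0$ and $$\bar Y_{22}=B+\bar y_2e^T+e\bar y_2^T\succeq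 0\quad\text{for some }\bar y_2\in\mathcal{R}(B)+\alpha e,\ \alpha\ge 0,\quad\text{with }\operatorname{rank}(\bar Y_{22})\le r.$$ 2. The feasible set $\mathcal{F}_G$ (defined in the context) can be formulated as $$\mathcal{F}_G=\left\{(P,\bar Y):\ Z=\begin{pmatrix}Z_{11}&Z_{21}^T&Z_{31}^T\\ Z_{21}&Z_{22}&Z_{32}^T\\ Z_{31}&Z_{32}&Z_{33}\end{pmatrix}\succeq 0,\ \bar Y=\begin{pmatrix}I_t&0&0\\0&U_2&0\\0&0&U\end{pmatrix}Z\begin{pmatrix}I_t&0&0\\0&U_2&0\\0&0&U\end{pmatrix}^T,\ Z_{33}=\Sigma_r^2,\ X=\begin{pmatrix}Z_{31}^T\\ U_2Z_{32}^T\end{pmatrix}\Sigma_r^{-1}V^T,\ P=\begin{pmatrix}X\\ A\end{pmatrix}\right\},$$ or equivalently as $$\mathcal{F}_G=\left\{(P,\bar Y):\ Z=\begin{pmatrix}Z_{11}&Z_{21}^T&Z_{31}^T\\ Z_{21}&Z_{22}&Z_{32}^T\\ Z_{31}&Z_{32}&Z_{33}\end{pmatrix}\succeq 0,\ \bar Y=\begin{pmatrix}I_t&0&0\\0&U_2&0\\0&0&A\end{pmatrix}Z\begin{pmatrix}I_t&0&0\\0&U_2&0\\0&0&A\end{pmatrix}^T,\ Z_{33}=I_r,\ X=\begin{pmatrix}Z_{31}^T\\ U_2Z_{32}^T\end{pmatrix},\ P=\begin{pmatrix}X\\ A\end{pmatrix}\right\},$$ where $$\hat B:=B+2ee^T=\begin{pmatrix}U_2&\bar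 U_2\end{pmatrix}\begin{pmatrix}D_2&0\\0&0\end{pmatrix}\begin{pmatrix}U_2&\bar U_2\end{pmatrix}^T$$ is the orthogonal diagonalization of $\hat B$, with $D_2\in\mathcal{S}^{r_2}_+$, $r_2\le r+1$.
   Context: $\mathcal{S}^k$ is the space of real symmetric $k\times k$ matrices, $\mathcal{S}^k_+$ its cone of positive semidefinite matrices, $\succeq$ and $\preceq$ refer to the Löwner (semidefinite) order, $e$ is the vector of ones of appropriate size, $I_k$ the $k\times k$ identity, and $\mathcal{R}(\cdot)$ the range. The linear operator $\mathcal{K}$ on symmetric matrices is $\mathcal{K}(B)=\operatorname{diag}(B)e^T+e\operatorname{diag}(B)^T-2B$, where $\operatorname{diag}(B)$ is the vector of diagonal entries. If $B=PP^T$, then $\mathcal{K}(B)_{ij}$ is the squared distance between rows $i$ and $j$ of $P$. Its Moore–Penrose generalized inverse on $\mathcal{S}^k$ is $\mathcal{K}^\dagger(D)=-\frac12J\,\operatorname{offDiag}(D)\,J$, where $J=I-\frac1kee^T$ and $\operatorname{offDiag}(D)$ is $D$ with its diagonal set to zero. There are $n$ unknown points (sensors) $p^1,\dots,p^n\in\mathbb{R}^r$, the rows of $X\in\mathbb{R}^{n\times r}$, and $m$ known points (anchors) in $\mathbb{R}^r$, the rows of $A\in\mathbb{R}^{m\times r}$; $r$ is the embedding dimension. The graph of the partial Euclidean distance matrix has the sensors and anchors as nodes, with an edge for each pair whose distance is known; all anchor-anchor distances are known. Standing assumption: $n\gg m>r$, $A^Te=0$, and $A$ has full column rank. The compact singular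 value decomposition of $A$ is $A=U\Sigma_rV^T$, where $U\in\mathbb{R}^{m\times r}$ has orthonormal columns, $\Sigma_r\in\mathcal{S}^r$ is diagonal and positive definite, and $V\in\mathbb{R}^{r\times r}$ is orthogonal. The feasible set $\mathcal{F}_G$ is that of the semidefinite relaxation of the constraint $\bar Y=PP^T$: it is the set of pairs $(P,\bar Y)$, with $P\in\mathbb{R}^{(n+m)\times r}$ and $\bar Y\in\mathcal{S}^{n+m}$, such that $PP^T-\bar Y\preceq 0$, the bottom right $m\times m$ block of $\bar Y$ equals $AA^T$, and the last $m$ rows of $P$ form $A$. In the two set descriptions in part 2, $(P,\bar Y)$ belongs to the set when some $Z$ and $X$ satisfying the listed conditions exist; $Z$ is symmetric with diagonal blocks $Z_{11}\in\mathcal{S}^t$, $Z_{22}\in\mathcal{S}^{r_2}$, $Z_{33}\in\mathcal{S}^r$. In the diagonalization of $\hat B$, the matrix $\begin{pmatrix}U_2&\bar U_2\end{pmatrix}$ is orthogonal, $U_2$ has $r_2$ columns, and $D_2$ is diagonal.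
   Formalization: F_G as defined imposes no distances within S_c, so the equalities in part 2 fail as stated; they are proved among pairs whose K(Ȳ) matches E on the known edges. That the two descriptions are equal and contained in F_G is proved without this restriction. *)

theory Defs
  imports
    "HOL-Library.Ramsey"
    "Jordan_Normal_Form.Matrix"
    "Jordan_Normal_Form.Gauss_Jordan_Elimination"
    "Jordan_Normal_Form.VS_Connect"
    "Jordan_Normal_Form.DL_Rank"
    "Jordan_Normal_Form.DL_Submatrix"
begin

definition ones_vec :: "nat \<Rightarrow> real vec" where
  "ones_vec k = vec k (\<lambda>_. 1)"

definition outer_prod :: "real vec \<Rightarrow> real vec \<Rightarrow> real mat" where
  "outer_prod u v = mat (dim_vec u) (dim_vec v) (\<lambda>(i, j). u $ i * v $ j)"

definition psd :: "real mat \<Rightarrow> bool" where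
  "psd M \<longleftrightarrow> square_mat M \<and> M\<^sup>T = M \<and>
     (\<forall>v \<in> carrier_vec (dim_row M). 0 \<le> v \<bullet> (M *\<^sub>v v))"

definition posdef :: "real mat \<Rightarrow> bool" where
  "posdef M \<longleftrightarrow> square_mat M \<and> M\<^sup>T = M \<and>
     (\<forall>v \<in> carrier_vec (dim_row M). v \<noteq> 0\<^sub>v (dim_row M) \<longrightarrow> 0 < v \<bullet> (M *\<^sub>v v))"

definition loewner_le :: "real mat \<Rightarrow> real mat \<Rightarrow> bool" where
  "loewner_le M N \<longleftrightarrow> psd (N - M)"

definition orthogonal_square :: "nat \<Rightarrow> real mat \<Rightarrow> bool" where
  "orthogonal_square k Q \<longleftrightarrow> Q \<in> carrier_mat k k \<and> Q\<^sup>T * Q = 1\<^sub>m k \<and> Q * Q\<^sup>T = 1\<^sub>m k"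

definition diag_of :: "real mat \<Rightarrow> real vec" where
  "diag_of B = vec_of_list (diag_mat B)"

definition edm_K :: "real mat \<Rightarrow> real mat" where
  "edm_K B = outer_prod (diag_of B) (ones_vec (dim_row B))
             + outer_prod (ones_vec (dim_row B)) (diag_of B) - 2 \<cdot>\<^sub>m B"

definition off_diag :: "real mat \<Rightarrow> real mat" where
  "off_diag D = mat (dim_row D) (dim_col D) (\<lambda>(i, j). if i = j then 0 else D $$ (i, j))"

definition centering :: "nat \<Rightarrow> real mat" where
  "centering k = 1\<^sub>m k - (1 / real k) \<cdot>\<^sub>m outer_prod (ones_vec k) (ones_vec k)"

text \<open>The Moore--Penrose inverse of \<^term>\<open>edm_K\<close> on symmetric matrices, through its closed
  formula.\<close>

definition edm_K_pinv :: "real mat \<Rightarrow> real mat" where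
  "edm_K_pinv D = (- 1 / 2) \<cdot>\<^sub>m (centering (dim_row D) * off_diag D * centering (dim_row D))"

definition compact_svd :: "nat \<Rightarrow> nat \<Rightarrow> real mat \<Rightarrow> real mat \<Rightarrow> real mat \<Rightarrow> real mat \<Rightarrow> bool" where
  "compact_svd m r A U \<Sigma> V \<longleftrightarrow>
     U \<in> carrier_mat m r \<and> U\<^sup>T * U = 1\<^sub>m r \<and>
     \<Sigma> \<in> carrier_mat r r \<and> diagonal_mat \<Sigma> \<and> posdef \<Sigma> \<and>
     orthogonal_square r V \<and>
     A = U * \<Sigma> * V\<^sup>T"

definition append_cols :: "real mat \<Rightarrow> real mat \<Rightarrow> real mat" where
  "append_cols M N = (M\<^sup>T @\<^sub>r N\<^sup>T)\<^sup>T"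

definition orth_diagonalization ::
    "nat \<Rightarrow> nat \<Rightarrow> real mat \<Rightarrow> real mat \<Rightarrow> real mat \<Rightarrow> real mat \<Rightarrow> bool" where
  "orth_diagonalization k r2 M U2 Ubar2 D2 \<longleftrightarrow>
     U2 \<in> carrier_mat k r2 \<and> Ubar2 \<in> carrier_mat k (k - r2) \<and>
     orthogonal_square k (append_cols U2 Ubar2) \<and>
     D2 \<in> carrier_mat r2 r2 \<and> diagonal_mat D2 \<and> psd D2 \<and>
     M = append_cols U2 Ubar2 * diag_block_mat [D2, 0\<^sub>m (k - r2) (k - r2)]
           * (append_cols U2 Ubar2)\<^sup>T"

text \<open>Indices start at \<open>0\<close>: the sensors are \<open>{0..<n}\<close> and the anchors \<open>{n..<n+m}\<close>.\<close>

definition feasible_FG :: "nat \<Rightarrow> nat \<Rightarrow> nat \<Rightarrow> real mat \<Rightarrow> (real mat \<times> real mat) set" where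
  "feasible_FG n m r A = {(P, Y).
     P \<in> carrier_mat (n + m) r \<and>
     Y \<in> carrier_mat (n + m) (n + m) \<and> Y\<^sup>T = Y \<and>
     loewner_le (P * P\<^sup>T - Y) (0\<^sub>m (n + m) (n + m)) \<and>
     submatrix Y {n..<n+m} {n..<n+m} = A * A\<^sup>T \<and>
     submatrix P {n..<n+m} {0..<r} = A}"

text \<open>Membership in \<^term>\<open>feasible_FG\<close> does not involve the known distances (apart from those
  among the anchors, fixed by the block \<open>A * A\<^sup>T\<close>); these are the separate constraint below:
  the pairs whose second component reproduces the squared distances of the partial
  Euclidean distance matrix, i.e. the entries of \<open>E\<close> at the edges of the graph.\<close>

definition match_known_distances ::
    "nat set set \<Rightarrow> real mat \<Rightarrow> (real mat \<times> real mat) set" where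
  "match_known_distances edges E =
     {(P, Y). \<forall>i j. {i, j} \<in> edges \<longrightarrow> edm_K Y $$ (i, j) = E $$ (i, j)}"

definition sym_block3 ::
    "real mat \<Rightarrow> real mat \<Rightarrow> real mat \<Rightarrow> real mat \<Rightarrow> real mat \<Rightarrow> real mat \<Rightarrow> real mat" where
  "sym_block3 Z11 Z21 Z22 Z31 Z32 Z33 =
     four_block_mat (four_block_mat Z11 (Z21\<^sup>T) Z21 Z22) (Z31\<^sup>T @\<^sub>r Z32\<^sup>T)
                    (append_cols Z31 Z32) Z33"

definition face_form_U :: "nat \<Rightarrow> nat \<Rightarrow> nat \<Rightarrow> real mat \<Rightarrow> real mat \<Rightarrow> real mat
    \<Rightarrow> real mat \<Rightarrow> real mat
    \<Rightarrow> (real mat \<times> real mat) set" where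
  "face_form_U t r2 r U2 A U \<Sigma> V = {(P, Y). \<exists>Z11 Z21 Z22 Z31 Z32 Z33 Z X.
     Z11 \<in> carrier_mat t t \<and> Z21 \<in> carrier_mat r2 t \<and> Z22 \<in> carrier_mat r2 r2 \<and>
     Z31 \<in> carrier_mat r t \<and> Z32 \<in> carrier_mat r r2 \<and> Z33 \<in> carrier_mat r r \<and>
     Z = sym_block3 Z11 Z21 Z22 Z31 Z32 Z33 \<and> psd Z \<and>
     Y = diag_block_mat [1\<^sub>m t, U2, U] * Z * (diag_block_mat [1\<^sub>m t, U2, U])\<^sup>T \<and>
     Z33 = \<Sigma> ^\<^sub>m 2 \<and>
     X = (Z31\<^sup>T @\<^sub>r (U2 * Z32\<^sup>T)) * the (mat_inverse \<Sigma>) * V\<^sup>T \<and>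
     P = X @\<^sub>r A}"

definition face_form_A :: "nat \<Rightarrow> nat \<Rightarrow> nat \<Rightarrow> real mat \<Rightarrow> real mat
    \<Rightarrow> (real mat \<times> real mat) set" where
  "face_form_A t r2 r U2 A = {(P, Y). \<exists>Z11 Z21 Z22 Z31 Z32 Z33 Z X.
     Z11 \<in> carrier_mat t t \<and> Z21 \<in> carrier_mat r2 t \<and> Z22 \<in> carrier_mat r2 r2 \<and>
     Z31 \<in> carrier_mat r t \<and> Z32 \<in> carrier_mat r r2 \<and> Z33 \<in> carrier_mat r r \<and>
     Z = sym_block3 Z11 Z21 Z22 Z31 Z32 Z33 \<and> psd Z \<and>
     Y = diag_block_mat [1\<^sub>m t, U2, A] * Z * (diag_block_mat [1\<^sub>m t, U2, A])\<^sup>T \<and>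
     Z33 = 1\<^sub>m r \<and>
     X = Z31\<^sup>T @\<^sub>r (U2 * Z32\<^sup>T) \<and>
     P = X @\<^sub>r A}"

end

theory Submission
  imports Defs "Jordan_Normal_Form.Spectral_Radius"
begin

text \<open>Let \<open>C = J P\<^sub>2\<close>. Double centering gives \<open>B = C C\<^sup>T\<close>, and it determines the Gram matrix of the clique up
  to \<open>y e\<^sup>T + e y\<^sup>T\<close>; part 1 then follows because the range of \<open>C C\<^sup>T\<close> is that of \<open>C\<close>.

  For part 2, let the columns of \<open>W\<close> span the orthogonal complement of the range of \<open>U\<^sub>2\<close>. Both
  summands of \<open>B + 2 e e\<^sup>T\<close> are positive semidefinite, hence \<open>B W = 0\<close> and \<open>e\<^sup>T W = 0\<close>,
  so \<open>W\<^sup>T Y\<^sub>2\<^sub>2 W = W\<^sup>T B W = 0\<close> for every feasible \<open>Y\<close> that matches the distances in the clique; as \<open>Y\<close> is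
  positive semidefinite, it vanishes on the lifted columns of \<open>W\<close>. Likewise \<open>Y - P P\<^sup>T\<close> has a zero anchor
  block, so it vanishes on the anchor coordinates. Hence \<open>Y = D D\<^sup>T Y D D\<^sup>T\<close> for the isometry
  \<open>D = diag(I, U\<^sub>2, U)\<close>, and \<open>Z = D\<^sup>T Y D\<close> is the required matrix. The other inclusion is a Schur complement
  argument, and the two descriptions differ by the change of basis \<open>diag(I, I, \<Sigma> V\<^sup>T)\<close>.\<close>

section \<open>Matrix algebra\<close>

text \<open>These rules state ring laws and transposition laws under equations between dimensions
  instead of carrier assumptions, so that the simplifier can discharge the side conditions from
  known dimensions. Collected in \<open>mat_dim_simps\<close>, they bring terms into expanded form
  with right-associated products.\<close>

lemma mat_assoc_dim:
  fixes A B C :: "'a :: comm_ring_1 mat"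
  assumes "dim_col A = dim_row B" "dim_col B = dim_row C"
  shows "A * B * C = A * (B * C)"
  using assms by (intro assoc_mult_mat) auto

lemma mat_transpose_mult_dim:
  fixes A B :: "'a :: comm_ring_1 mat"
  assumes "dim_col A = dim_row B"
  shows "(A * B)\<^sup>T = B\<^sup>T * A\<^sup>T"
  using assms by (intro transpose_mult) auto

lemma mat_add_distrib_right_dim:
  fixes A B C :: "'a :: comm_ring_1 mat"
  assumes "dim_row A = dim_row B" "dim_col A = dim_col B" "dim_col A = dim_row C"
  shows "(A + B) * C = A * C + B * C"
  using assms by (intro add_mult_distrib_mat) auto

lemma mat_add_distrib_left_dim:
  fixes A B C :: "'a :: comm_ring_1 mat"
  assumes "dim_row B = dim_row C" "dim_col B = dim_col C" "dim_col A = dim_row B"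
  shows "A * (B + C) = A * B + A * C"
  using assms by (intro mult_add_distrib_mat) auto

lemma mat_minus_distrib_right_dim:
  fixes A B C :: "'a :: comm_ring_1 mat"
  assumes "dim_row A = dim_row B" "dim_col A = dim_col B" "dim_col A = dim_row C"
  shows "(A - B) * C = A * C - B * C"
  using assms by (intro minus_mult_distrib_mat) auto

lemma mat_minus_distrib_left_dim:
  fixes A B C :: "'a :: comm_ring_1 mat"
  assumes "dim_row B = dim_row C" "dim_col B = dim_col C" "dim_col A = dim_row B"
  shows "A * (B - C) = A * B - A * C"
  using assms by (intro mult_minus_distrib_mat) auto

lemma mat_transpose_add_dim:
  assumes "dim_row A = dim_row B" "dim_col A = dim_col B"
  shows "(A + B)\<^sup>T = A\<^sup>T + B\<^sup>T"
  using assms by (intro transpose_add) auto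

lemma mat_transpose_minus_dim:
  assumes "dim_row A = dim_row B" "dim_col A = dim_col B"
  shows "(A - B)\<^sup>T = A\<^sup>T - B\<^sup>T"
  using assms by (intro transpose_minus) auto

lemma mat_smult_mult_dim:
  fixes A B :: "'a :: comm_ring_1 mat"
  assumes "dim_col A = dim_row B"
  shows "(k \<cdot>\<^sub>m A) * B = k \<cdot>\<^sub>m (A * B)"
  using assms by (intro mult_smult_assoc_mat) auto

lemma mat_mult_smult_dim:
  fixes A B :: "'a :: comm_ring_1 mat"
  assumes "dim_col A = dim_row B"
  shows "A * (k \<cdot>\<^sub>m B) = k \<cdot>\<^sub>m (A * B)"
  using assms by (intro mult_smult_distrib) auto

lemmas mat_dim_simps =
  mat_assoc_dim mat_transpose_mult_dim mat_add_distrib_right_dim mat_add_distrib_left_dim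
  mat_minus_distrib_right_dim mat_minus_distrib_left_dim mat_transpose_add_dim
  mat_transpose_minus_dim mat_smult_mult_dim mat_mult_smult_dim

text \<open>In a right-associated product \<open>A * (B * X)\<close> the term \<open>A * B\<close>
  is not a subterm, so an equation for it cannot be applied directly. This form rewrites the head of
  a longer product; the fact lists called \<open>cancel\<close> are built from it.\<close>

lemma mat_mult_left_cong:
  fixes A B C :: "'a :: comm_ring_1 mat"
  assumes "A * B = C" "dim_col A = dim_row B" "dim_col B = dim_row X"
  shows "A * (B * X) = C * X"
  using assms by (metis mat_assoc_dim)

lemma mat_eq_of_minus_eq_zero:
  fixes A B :: "'a :: ab_group_add mat"
  assumes "A - B = 0\<^sub>m n k" "A \<in> carrier_mat n k" "B \<in> carrier_mat n k"
  shows "A = B"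
proof (rule eq_matI)
  fix i j assume "i < dim_row B" "j < dim_col B"
  then have "(A - B) $$ (i, j) = 0" unfolding assms(1) using assms(2,3) by auto
  then show "A $$ (i, j) = B $$ (i, j)" using \<open>i < dim_row B\<close> \<open>j < dim_col B\<close> by simp
qed (use assms in auto)

section \<open>Positive semidefinite matrices\<close>

lemma psd_iff:
  assumes "M \<in> carrier_mat n n"
  shows "psd M \<longleftrightarrow> M\<^sup>T = M \<and> (\<forall>v \<in> carrier_vec n. 0 \<le> v \<bullet> (M *\<^sub>v v))"
  using assms unfolding psd_def by auto

lemma quadratic_form_congruence:
  fixes M W :: "real mat"
  assumes "M \<in> carrier_mat n n" "W \<in> carrier_mat n k" "v \<in> carrier_vec k"
  shows "v \<bullet> ((W\<^sup>T * M * W) *\<^sub>v v) = (W *\<^sub>v v) \<bullet> (M *\<^sub>v (W *\<^sub>v v))"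
proof -
  have "(W\<^sup>T * M * W) *\<^sub>v v = W\<^sup>T *\<^sub>v (M *\<^sub>v (W *\<^sub>v v))"
    using assms by (simp add: assoc_mult_mat_vec[of _ k n _ k] assoc_mult_mat_vec[of _ k n _ n])
  moreover have "M *\<^sub>v (W *\<^sub>v v) \<in> carrier_vec n" using assms by auto
  ultimately show ?thesis
    using transpose_vec_mult_scalar[of "W\<^sup>T" k n "M *\<^sub>v (W *\<^sub>v v)" v] assms
    by simp
qed

lemma psd_congruence:
  assumes "psd M" "M \<in> carrier_mat n n" "W \<in> carrier_mat n k"
  shows "psd (W\<^sup>T * M * W)"
proof -
  have "M\<^sup>T = M" using assms psd_iff by blast
  then have "(W\<^sup>T * M * W)\<^sup>T = W\<^sup>T * M * W"
    using assms(2,3) by (simp add: mat_dim_simps)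
  moreover have "0 \<le> v \<bullet> ((W\<^sup>T * M * W) *\<^sub>v v)" if "v \<in> carrier_vec k" for v
  proof -
    have "W *\<^sub>v v \<in> carrier_vec n" using assms(3) that by auto
    then show ?thesis
      unfolding quadratic_form_congruence[OF assms(2,3) that] using assms(1) psd_iff[OF assms(2)] by blast
  qed
  ultimately show ?thesis using assms by (subst psd_iff[of _ k]) auto
qed

lemma psd_one: "psd (1\<^sub>m n)"
  by (subst psd_iff[of _ n]) (auto simp: scalar_prod_def intro!: sum_nonneg)

lemma psd_gram: "psd (F * F\<^sup>T)"
proof -
  have "psd (F\<^sup>T\<^sup>T * 1\<^sub>m (dim_col F) * F\<^sup>T)"
    by (rule psd_congruence[OF psd_one]) auto
  then show ?thesis by simp
qed

lemma psd_add:
  assumes "psd M" "psd N" "M \<in> carrier_mat n n" "N \<in> carrier_mat n n"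
  shows "psd (M + N)"
proof -
  have "0 \<le> v \<bullet> ((M + N) *\<^sub>v v)" if v: "v \<in> carrier_vec n" for v
  proof -
    have "v \<bullet> ((M + N) *\<^sub>v v) = v \<bullet> (M *\<^sub>v v) + v \<bullet> (N *\<^sub>v v)"
      using assms v
      by (simp add: add_mult_distrib_mat_vec[of _ n n] scalar_prod_add_distrib[of _ n])
    then show ?thesis using assms v by (simp add: psd_iff[of _ n])
  qed
  then show ?thesis
    using assms by (simp add: psd_iff[of _ n] transpose_add[of _ n n])
qed

text \<open>The quadratic form is nonnegative and zero at \<open>v\<close>, so \<open>v\<close> is a
  minimum and the form has zero derivative there. Moving from \<open>v\<close> by \<open>-e\<close>
  times \<open>u = M *\<^sub>v v\<close> gives the value \<open>e * e * b - 2 * e * a\<close> with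
  \<open>a = u \<bullet> u\<close>; nonnegativity for every \<open>e\<close> forces
  \<open>a = 0\<close>.\<close>

lemma psd_kernel:
  assumes M: "psd M" "M \<in> carrier_mat n n" and v: "v \<in> carrier_vec n" "v \<bullet> (M *\<^sub>v v) = 0"
  shows "M *\<^sub>v v = 0\<^sub>v n"
proof -
  define u where "u = M *\<^sub>v v"
  define a where "a = u \<bullet> u"
  define b where "b = u \<bullet> (M *\<^sub>v u)"
  have u: "u \<in> carrier_vec n" using M v by (auto simp: u_def)
  have Mu: "M *\<^sub>v u \<in> carrier_vec n" using M u by auto
  have sym: "M\<^sup>T = M" using M psd_iff by blast
  have vMu: "v \<bullet> (M *\<^sub>v u) = a"
    using transpose_vec_mult_scalar[OF M(2) u v(1)] sym comm_scalar_prod[OF u u]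
    by (simp add: a_def u_def)
  have nonneg: "0 \<le> e * e * b - 2 * e * a" for e
  proof -
    have "M *\<^sub>v (v - e \<cdot>\<^sub>v u) = u - e \<cdot>\<^sub>v (M *\<^sub>v u)"
      using M u v by (simp add: mult_minus_distrib_mat_vec[of _ n n] mult_mat_vec[of _ n n] u_def)
    then have "(v - e \<cdot>\<^sub>v u) \<bullet> (M *\<^sub>v (v - e \<cdot>\<^sub>v u))
        = (v \<bullet> u - e * (v \<bullet> (M *\<^sub>v u))) - e * (u \<bullet> u - e * (u \<bullet> (M *\<^sub>v u)))"
      using u v Mu
      by (simp add: minus_scalar_prod_distrib[of _ n] scalar_prod_minus_distrib[of _ n] right_diff_distrib)
    also have "\<dots> = e * e * b - 2 * e * a"
      using v(2) by (simp add: vMu a_def b_def u_def[symmetric] algebra_simps)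
    finally show ?thesis
      using M u v psd_iff[OF M(2)] by (metis minus_carrier_vec smult_carrier_vec)
  qed
  have "a \<ge> 0" unfolding a_def scalar_prod_def by (intro sum_nonneg) auto
  moreover have "\<not> a > 0"
  proof
    assume a: "a > 0"
    \<comment> \<open>The step length \<open>a / c\<close> is short enough for the linear term to
      dominate: \<open>c\<close> is positive and exceeds \<open>b\<close>, so
      \<open>b / c - 2\<close> is negative.\<close>
    define c where "c = \<bar>b\<bar> + 1"
    have c: "c > 0" "b < c" by (auto simp: c_def)
    have "0 \<le> (a / c) * (a / c) * b - 2 * (a / c) * a" by (rule nonneg)
    also have "\<dots> = (a / c) * (a * (b / c - 2))" using c by (simp add: field_simps)
    finally have nn: "0 \<le> (a / c) * (a * (b / c - 2))" .
    have "b / c - 2 < 0" using c by (simp add: field_simps)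
    then have "(a / c) * (a * (b / c - 2)) < 0" using a c by (intro mult_pos_neg) auto
    then show False using nn by simp
  qed
  ultimately have "u \<bullet> u = 0" by (simp add: a_def)
  then show ?thesis using u conjugate_square_eq_0_vec[of u n] by (simp add: u_def)
qed

lemma index_congruence:
  fixes M W :: "real mat"
  assumes "M \<in> carrier_mat n n" "W \<in> carrier_mat n k" "j < k"
  shows "(W\<^sup>T * M * W) $$ (j, j) = col W j \<bullet> (M *\<^sub>v col W j)"
proof -
  have "W\<^sup>T * M * W = W\<^sup>T * (M * W)" using assms by (simp add: mat_assoc_dim)
  moreover have "col (M * W) j = M *\<^sub>v col W j"
    using assms by (intro eq_vecI) auto
  ultimately show ?thesis using assms by simp
qed

text \<open>The diagonal entries of \<open>W\<^sup>T * M * W\<close> are the values of the quadratic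
  form at the columns of \<open>W\<close>, so each column lies in the kernel.\<close>

lemma psd_kernel_mat:
  assumes M: "psd M" "M \<in> carrier_mat n n" and W: "W \<in> carrier_mat n k"
    and zero: "W\<^sup>T * M * W = 0\<^sub>m k k"
  shows "M * W = 0\<^sub>m n k"
proof (rule mat_col_eqI)
  fix j assume "j < dim_col (0\<^sub>m n k :: real mat)"
  then have j: "j < k" by simp
  have "col W j \<bullet> (M *\<^sub>v col W j) = 0"
    using index_congruence[OF M(2) W j] zero j by simp
  then have "M *\<^sub>v col W j = 0\<^sub>v n"
    using psd_kernel[OF M, of "col W j"] W j by auto
  moreover have "col (M * W) j = M *\<^sub>v col W j"
    using M W j by (intro eq_vecI) auto
  ultimately show "col (M * W) j = col (0\<^sub>m n k) j" using j by simp
qed (use M W in auto)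

text \<open>When \<open>E\<close> selects coordinates whose block in \<open>Z\<close> is the
  identity, the matrix is the Schur complement of that block, padded with zeros to full size. It is
  positive semidefinite because it is a congruence of \<open>Z\<close>.\<close>

lemma psd_schur_complement:
  assumes Z: "psd Z" "Z \<in> carrier_mat n n" and E: "E \<in> carrier_mat n r"
    and one: "E\<^sup>T * Z * E = 1\<^sub>m r"
  shows "psd (Z - (Z * E) * (Z * E)\<^sup>T)"
proof -
  have sym: "Z\<^sup>T = Z" using Z psd_iff by blast
  note [simp] = carrier_matD[OF Z(2)] carrier_matD[OF E]
  define G where "G = Z * E * (Z * E)\<^sup>T"
  have G: "G \<in> carrier_mat n n" by (auto simp: G_def intro!: carrier_matI)
  have GE: "G = Z * (E * (E\<^sup>T * Z))" by (simp add: G_def mat_dim_simps sym)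
  have one': "E\<^sup>T * (Z * E) = 1\<^sub>m r" using one by (simp add: mat_dim_simps)
  have GG: "Z * (E * (E\<^sup>T * (Z * (E * (E\<^sup>T * Z))))) = G"
  proof -
    have "E\<^sup>T * (Z * (E * (E\<^sup>T * Z))) = (E\<^sup>T * (Z * E)) * (E\<^sup>T * Z)"
      by (simp add: mat_dim_simps)
    then show ?thesis by (simp add: one' GE)
  qed
  \<comment> \<open>The projection that annihilates the columns of \<open>E\<close> and is
    self-adjoint for the bilinear form of \<open>Z\<close>; idempotence comes from
    \<open>one\<close>.\<close>
  define W where "W = 1\<^sub>m n - E * (E\<^sup>T * Z)"
  have W: "W \<in> carrier_mat n n" by (auto simp: W_def intro!: carrier_matI)
  have "W\<^sup>T * Z * W = (Z - Z * (E * (E\<^sup>T * Z)))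
      - (Z * (E * (E\<^sup>T * Z)) - Z * (E * (E\<^sup>T * (Z * (E * (E\<^sup>T * Z))))))"
    by (simp add: W_def mat_dim_simps sym)
  also have "\<dots> = (Z - G) - (G - G)" by (simp only: GG) (simp only: GE)
  also have "\<dots> = Z - G" using G by (intro eq_matI) auto
  finally show ?thesis using psd_congruence[OF Z W] by (simp add: G_def)
qed

section \<open>Block matrices\<close>

text \<open>A binary form of \<open>diag_block_mat\<close>, for which transposition, product and sum
  can be computed blockwise under dimension equations. Lists of two or three blocks are converted to
  it below.\<close>

definition block_diag :: "real mat \<Rightarrow> real mat \<Rightarrow> real mat" where
  "block_diag A B =
     four_block_mat A (0\<^sub>m (dim_row A) (dim_col B)) (0\<^sub>m (dim_row B) (dim_col A)) B"

lemma block_diag_dim [simp]: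
  "dim_row (block_diag A B) = dim_row A + dim_row B"
  "dim_col (block_diag A B) = dim_col A + dim_col B"
  by (simp_all add: block_diag_def)

lemma diag_block_mat_two: "diag_block_mat [A, B] = block_diag A B"
  by (simp only: diag_block_mat.simps(2)[of A] diag_block_mat_singleton Let_def block_diag_def)

lemma diag_block_mat_three: "diag_block_mat [A, B, C] = block_diag A (block_diag B C)"
  by (simp only: diag_block_mat.simps(2)[of A] diag_block_mat_two Let_def block_diag_def[of A])

lemma block_diag_assoc: "block_diag A (block_diag B C) = block_diag (block_diag A B) C"
  using assoc_four_block_mat[of A B C] by (simp add: block_diag_def)

lemma block_diag_transpose: "(block_diag A B)\<^sup>T = block_diag A\<^sup>T B\<^sup>T"
  unfolding block_diag_def
  by (subst transpose_four_block_mat[of _ "dim_row A" "dim_col A" _ "dim_col B" _ "dim_row B"]) auto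

lemma block_diag_mult:
  assumes "dim_col A = dim_row C" "dim_col B = dim_row D"
  shows "block_diag A B * block_diag C D = block_diag (A * C) (B * D)"
  unfolding block_diag_def
  by (subst mult_four_block_mat[of _ "dim_row A" "dim_col A" _ "dim_col B" _ "dim_row B" _ _ "dim_col C"
        _ "dim_col D"]) (use assms in auto)

lemma block_diag_one: "block_diag (1\<^sub>m m) (1\<^sub>m n) = 1\<^sub>m (m + n)"
  by (simp add: block_diag_def)

lemma block_diag_zero: "block_diag (0\<^sub>m m m') (0\<^sub>m n n') = 0\<^sub>m (m + n) (m' + n')"
  by (simp add: block_diag_def)

lemma block_diag_add:
  assumes "dim_row A = dim_row C" "dim_col A = dim_col C" "dim_row B = dim_row D" "dim_col B = dim_col D"
  shows "block_diag A B + block_diag C D = block_diag (A + C) (B + D)"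
  unfolding block_diag_def using assms by (intro eq_matI) auto

lemma append_rows_dim [simp]:
  "dim_row (A @\<^sub>r B) = dim_row A + dim_row B" "dim_col (A @\<^sub>r B) = dim_col A"
  by (simp_all add: append_rows_def)

lemma block_diag_mult_append_rows:
  assumes "dim_col A = dim_row X" "dim_col B = dim_row Y" "dim_col X = dim_col Y"
  shows "block_diag A B * (X @\<^sub>r Y) = (A * X) @\<^sub>r (B * Y)"
  unfolding block_diag_def append_rows_def
  by (subst mult_four_block_mat[of _ "dim_row A" "dim_col A" _ "dim_col B" _ "dim_row B" _ _ "dim_col X"
        _ 0]) (use assms in auto)

lemma append_rows_mult:
  fixes A B X :: "real mat"
  assumes "dim_col A = dim_row X" "dim_col B = dim_row X"
  shows "(A @\<^sub>r B) * X = (A * X) @\<^sub>r (B * X)"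
proof -
  \<comment> \<open>\<open>A @\<^sub>r B\<close> is a four-block matrix whose right column of blocks
    has width 0. Padding \<open>X\<close> with empty blocks makes the block product formula
    applicable.\<close>
  have X: "X = four_block_mat X (0\<^sub>m (dim_row X) 0) (0\<^sub>m 0 (dim_col X)) (0\<^sub>m 0 0)"
    by (rule eq_matI) auto
  show ?thesis unfolding append_rows_def
    by (subst X, subst mult_four_block_mat[of _ "dim_row A" "dim_row X" _ 0 _ "dim_row B" _ _ "dim_col X" _ 0])
      (use assms in auto)
qed

lemma append_rows_transpose_mult:
  fixes A B X Y :: "real mat"
  assumes "dim_row A = dim_row X" "dim_row B = dim_row Y" "dim_col A = dim_col B" "dim_col X = dim_col Y"
  shows "(A @\<^sub>r B)\<^sup>T * (X @\<^sub>r Y) = A\<^sup>T * X + B\<^sup>T * Y"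
proof -
  have 1: "(A @\<^sub>r B)\<^sup>T = four_block_mat A\<^sup>T B\<^sup>T (0\<^sub>m 0 (dim_row A)) (0\<^sub>m 0 (dim_row B))"
    unfolding append_rows_def
    by (subst transpose_four_block_mat[of _ "dim_row A" "dim_col A" _ 0 _ "dim_row B"]) (use assms in auto)
  show ?thesis
    unfolding 1 unfolding append_rows_def
    by (subst mult_four_block_mat[of _ "dim_col A" "dim_row A" _ "dim_row B" _ 0 _ _ "dim_col X" _ 0])
      (use assms in auto)
qed

lemma append_rows_inj:
  assumes "A @\<^sub>r B = C @\<^sub>r D" "dim_row A = dim_row C" "dim_col A = dim_col B" "dim_col C = dim_col D"
  shows "A = C" "B = D"
proof -
  have d: "dim_col A = dim_col C" "dim_row B = dim_row D"
    using arg_cong[OF assms(1), of dim_col] arg_cong[OF assms(1), of dim_row] assms(2-) by simp_all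
  show "A = C"
  proof (rule eq_matI)
    fix i j assume "i < dim_row C" "j < dim_col C"
    then show "A $$ (i, j) = C $$ (i, j)"
      using arg_cong[OF assms(1), of "\<lambda>M. M $$ (i, j)"] assms(2-) d by (simp add: append_rows_def)
  qed (use assms d in auto)
  show "B = D"
  proof (rule eq_matI)
    fix i j assume "i < dim_row D" "j < dim_col D"
    then show "B $$ (i, j) = D $$ (i, j)"
      using arg_cong[OF assms(1), of "\<lambda>M. M $$ (dim_row A + i, j)"] assms(2-) d
      by (simp add: append_rows_def)
  qed (use assms d in auto)
qed

lemma append_cols_dim [simp]:
  "dim_row (append_cols A B) = dim_row A" "dim_col (append_cols A B) = dim_col A + dim_col B"
  by (simp_all add: append_cols_def)

lemma append_cols_transpose: "(append_cols A B)\<^sup>T = A\<^sup>T @\<^sub>r B\<^sup>T"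
  by (simp add: append_cols_def)

lemma append_cols_mult_append_rows:
  assumes "dim_col A = dim_row X" "dim_col B = dim_row Y" "dim_row A = dim_row B" "dim_col X = dim_col Y"
  shows "append_cols A B * (X @\<^sub>r Y) = A * X + B * Y"
  using append_rows_transpose_mult[of "A\<^sup>T" X "B\<^sup>T" Y] assms by (simp add: append_cols_def)

lemma append_cols_mult_block_diag:
  assumes "dim_col A = dim_row X" "dim_col B = dim_row Y" "dim_row A = dim_row B"
  shows "append_cols A B * block_diag X Y = append_cols (A * X) (B * Y)"
proof -
  have "(append_cols A B * block_diag X Y)\<^sup>T = block_diag X\<^sup>T Y\<^sup>T * (A\<^sup>T @\<^sub>r B\<^sup>T)"
    using assms by (simp add: mat_transpose_mult_dim block_diag_transpose append_cols_transpose)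
  also have "\<dots> = (append_cols (A * X) (B * Y))\<^sup>T"
    using assms by (simp add: mat_transpose_mult_dim append_cols_transpose block_diag_mult_append_rows)
  finally show ?thesis by simp
qed

lemma append_cols_split:
  assumes "Q \<in> carrier_mat n (a + b)"
  obtains A B where "A \<in> carrier_mat n a" "B \<in> carrier_mat n b" "Q = append_cols A B"
proof
  show "Q = append_cols (mat n a (\<lambda>(i, j). Q $$ (i, j))) (mat n b (\<lambda>(i, j). Q $$ (i, a + j)))"
    using assms by (intro eq_matI) (auto simp: append_cols_def append_rows_def)
qed auto

lemma four_block_mat_inj:
  assumes eq: "four_block_mat A B C D = four_block_mat A' B' C' D'"
    and "A \<in> carrier_mat r1 c1" "B \<in> carrier_mat r1 c2" "C \<in> carrier_mat r2 c1" "D \<in> carrier_mat r2 c2"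
    and "A' \<in> carrier_mat r1 c1" "B' \<in> carrier_mat r1 c2" "C' \<in> carrier_mat r2 c1" "D' \<in> carrier_mat r2 c2"
  shows "A = A'" "B = B'" "C = C'" "D = D'"
proof -
  have e: "four_block_mat A B C D $$ (i, j) = four_block_mat A' B' C' D' $$ (i, j)" for i j
    using eq by simp
  show "A = A'"
  proof (rule eq_matI)
    fix i j assume "i < dim_row A'" "j < dim_col A'"
    then show "A $$ (i, j) = A' $$ (i, j)" using e[of i j] assms(2-) by simp
  qed (use assms in auto)
  show "B = B'"
  proof (rule eq_matI)
    fix i j assume "i < dim_row B'" "j < dim_col B'"
    then show "B $$ (i, j) = B' $$ (i, j)" using e[of i "c1 + j"] assms(2-) by simp
  qed (use assms in auto)
  show "C = C'"
  proof (rule eq_matI)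
    fix i j assume "i < dim_row C'" "j < dim_col C'"
    then show "C $$ (i, j) = C' $$ (i, j)" using e[of "r1 + i" j] assms(2-) by simp
  qed (use assms in auto)
  show "D = D'"
  proof (rule eq_matI)
    fix i j assume "i < dim_row D'" "j < dim_col D'"
    then show "D $$ (i, j) = D' $$ (i, j)" using e[of "r1 + i" "c1 + j"] assms(2-) by simp
  qed (use assms in auto)
qed

lemma four_block_mat_split:
  assumes "M \<in> carrier_mat (m + n) (m + n)"
  obtains A B C D where "A \<in> carrier_mat m m" "B \<in> carrier_mat m n" "C \<in> carrier_mat n m"
    "D \<in> carrier_mat n n" "M = four_block_mat A B C D"
proof -
  obtain A B C D where "split_block M m m = (A, B, C, D)" by (metis prod_cases4)
  from split_block[OF this, of n n] show ?thesis using that assms by auto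
qed

lemma append_cols_gram:
  assumes "A \<in> carrier_mat n a" "B \<in> carrier_mat n b"
  shows "(append_cols A B)\<^sup>T * append_cols A B = four_block_mat (A\<^sup>T * A) (A\<^sup>T * B) (B\<^sup>T * A) (B\<^sup>T * B)"
proof -
  have c: "append_cols A B = four_block_mat A B (0\<^sub>m 0 a) (0\<^sub>m 0 b)"
    using assms by (intro eq_matI) (auto simp: append_cols_def append_rows_def)
  show ?thesis
    unfolding append_cols_transpose unfolding c append_rows_def
    by (subst mult_four_block_mat[of _ a n _ 0 _ b _ _ a _ b]) (use assms in auto)
qed

lemma orthogonal_append_colsD:
  assumes Q: "orthogonal_square k (append_cols U W)"
    and U: "U \<in> carrier_mat k r2" and W: "W \<in> carrier_mat k (k - r2)"
  shows "r2 \<le> k" "U\<^sup>T * U = 1\<^sub>m r2" "U\<^sup>T * W = 0\<^sub>m r2 (k - r2)"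
    "U * U\<^sup>T + W * W\<^sup>T = 1\<^sub>m k"
proof -
  note [simp] = carrier_matD[OF U] carrier_matD[OF W]
  have Qc: "append_cols U W \<in> carrier_mat k k"
    and QQ: "(append_cols U W)\<^sup>T * append_cols U W = 1\<^sub>m k"
    and QQ': "append_cols U W * (append_cols U W)\<^sup>T = 1\<^sub>m k"
    using Q by (auto simp: orthogonal_square_def)
  \<comment> \<open>The subtraction in \<open>k - r2\<close> is truncated. Since the combined matrix
    has \<open>r2 + (k - r2)\<close> columns and this number is \<open>k\<close>, the case
    \<open>r2 > k\<close> is excluded.\<close>
  show r2: "r2 \<le> k" using carrier_matD(2)[OF Qc] by simp
  have "four_block_mat (U\<^sup>T * U) (U\<^sup>T * W) (W\<^sup>T * U) (W\<^sup>T * W)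
      = four_block_mat (1\<^sub>m r2) (0\<^sub>m r2 (k - r2)) (0\<^sub>m (k - r2) r2) (1\<^sub>m (k - r2))"
    using append_cols_gram[OF U W] QQ r2 by simp
  note blocks = four_block_mat_inj[OF this, of r2 r2 "k - r2" "k - r2"]
  show "U\<^sup>T * U = 1\<^sub>m r2" by (rule blocks) auto
  show "U\<^sup>T * W = 0\<^sub>m r2 (k - r2)" by (rule blocks) auto
  show "U * U\<^sup>T + W * W\<^sup>T = 1\<^sub>m k"
    using QQ' by (simp add: append_cols_transpose append_cols_mult_append_rows)
qed

lemma append_cols_compact_form:
  assumes "U \<in> carrier_mat k r2" "W \<in> carrier_mat k s" "D \<in> carrier_mat r2 r2"
  shows "append_cols U W * block_diag D (0\<^sub>m s s) * (append_cols U W)\<^sup>T = U * D * U\<^sup>T"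
  unfolding append_cols_transpose using assms
  by (subst append_cols_mult_block_diag, simp, simp, simp, subst append_cols_mult_append_rows)
    (auto intro!: right_add_zero_mat)

text \<open>The compact form in which diagonalizations are used: the zero block removes
  \<open>W\<close> from the product, and then \<open>W\<close> lies in the kernel of
  \<open>M\<close> because its columns are orthogonal to those of \<open>U\<close>.\<close>

lemma orth_diagonalizationD:
  assumes "orth_diagonalization k r2 M U W D"
  shows "r2 \<le> k" "U \<in> carrier_mat k r2" "W \<in> carrier_mat k (k - r2)" "D \<in> carrier_mat r2 r2"
    "U\<^sup>T * U = 1\<^sub>m r2" "U * U\<^sup>T + W * W\<^sup>T = 1\<^sub>m k" "M = U * D * U\<^sup>T" "M * W = 0\<^sub>m k (k - r2)"
proof -
  show U: "U \<in> carrier_mat k r2" and W: "W \<in> carrier_mat k (k - r2)" and D: "D \<in> carrier_mat r2 r2"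
    using assms by (auto simp: orth_diagonalization_def)
  have Q: "orthogonal_square k (append_cols U W)" using assms by (simp add: orth_diagonalization_def)
  note facts = orthogonal_append_colsD[OF Q U W]
  show "r2 \<le> k" "U\<^sup>T * U = 1\<^sub>m r2" "U * U\<^sup>T + W * W\<^sup>T = 1\<^sub>m k" by (fact facts)+
  show M: "M = U * D * U\<^sup>T"
    using assms append_cols_compact_form[OF U W D]
    by (simp add: orth_diagonalization_def diag_block_mat_two del: diag_block_mat.simps)
  show "M * W = 0\<^sub>m k (k - r2)"
    unfolding M using U W D facts(3) by (simp add: mat_dim_simps)
qed

section \<open>The spectral theorem for real symmetric matrices\<close>

text \<open>An eigenvalue \<open>z\<close> exists over the complex numbers. Evaluating
  \<open>w \<bullet> (?C *\<^sub>v conjugate w)\<close> on either side of the form by symmetry shows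
  that \<open>z\<close> equals its conjugate.\<close>

lemma real_symmetric_eigenvector:
  fixes M :: "real mat"
  assumes M: "M \<in> carrier_mat n n" and sym: "M\<^sup>T = M" and n: "n > 0"
  obtains l v where "v \<in> carrier_vec n" "v \<bullet> v = 1" "M *\<^sub>v v = l \<cdot>\<^sub>v v"
proof -
  let ?C = "map_mat complex_of_real M"
  have C: "?C \<in> carrier_mat n n" using M by simp
  have Csym: "?C\<^sup>T = ?C" using sym by (simp add: map_mat_transpose)
  from spectrum_non_empty[OF C n] obtain z where z: "eigenvalue ?C z" by (auto simp: spectrum_def)
  then obtain w where w: "w \<in> carrier_vec n" "w \<noteq> 0\<^sub>v n" "?C *\<^sub>v w = z \<cdot>\<^sub>v w"
    using M by (auto simp: eigenvalue_def eigenvector_def)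
  have cw: "conjugate w \<in> carrier_vec n" using w by simp
  have "?C *\<^sub>v conjugate w = conjugate (?C *\<^sub>v w)"
    using M w(1) by (intro eq_vecI) (auto simp: scalar_prod_def)
  also have "\<dots> = cnj z \<cdot>\<^sub>v conjugate w"
    by (subst w(3), intro eq_vecI) auto
  finally have Ccw: "?C *\<^sub>v conjugate w = cnj z \<cdot>\<^sub>v conjugate w" .
  have "z * (w \<bullet> conjugate w) = (?C\<^sup>T *\<^sub>v w) \<bullet> conjugate w"
    unfolding Csym w(3) using w cw by simp
  also have "\<dots> = w \<bullet> (?C *\<^sub>v conjugate w)"
    by (rule transpose_vec_mult_scalar[OF C cw w(1)])
  also have "\<dots> = cnj z * (w \<bullet> conjugate w)"
    unfolding Ccw using w cw by simp
  finally have "z = cnj z" using w by simp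
  then have zr: "z = complex_of_real (Re z)" by (simp add: complex_eq_iff)
  \<comment> \<open>The complex eigenvector \<open>w\<close> may be non-real. A real eigenvector is
    obtained through the characteristic polynomial of \<open>M\<close>, which now has the real root
    \<open>Re z\<close>.\<close>
  have "poly (char_poly ?C) z = 0" using z eigenvalue_root_char_poly[OF C] by simp
  then have "poly (map_poly complex_of_real (char_poly M)) (complex_of_real (Re z)) = 0"
    using zr of_real_hom.char_poly_hom[OF M, where 'a = complex] by simp
  then have "eigenvalue M (Re z)" using eigenvalue_root_char_poly[OF M] by simp
  then obtain v where v: "v \<in> carrier_vec n" "v \<noteq> 0\<^sub>v n" "M *\<^sub>v v = Re z \<cdot>\<^sub>v v"
    using M by (auto simp: eigenvalue_def eigenvector_def)
  have "v \<bullet> v > 0" using conjugate_square_greater_0_vec[OF v(1)] v(2) by simp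
  then have "(1 / sqrt (v \<bullet> v) \<cdot>\<^sub>v v) \<bullet> (1 / sqrt (v \<bullet> v) \<cdot>\<^sub>v v) = 1"
    using v by (simp add: field_simps)
  moreover have "M *\<^sub>v (1 / sqrt (v \<bullet> v) \<cdot>\<^sub>v v) = Re z \<cdot>\<^sub>v (1 / sqrt (v \<bullet> v) \<cdot>\<^sub>v v)"
    using v M by (simp add: mult_mat_vec[of _ n n] smult_smult_assoc mult.commute)
  ultimately show ?thesis using that[of "1 / sqrt (v \<bullet> v) \<cdot>\<^sub>v v"] v(1) by (metis smult_carrier_vec)
qed

lemma outer_prod_dim [simp]:
  "dim_row (outer_prod u v) = dim_vec u" "dim_col (outer_prod u v) = dim_vec v"
  by (simp_all add: outer_prod_def)

lemma outer_prod_index [simp]: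
  "i < dim_vec u \<Longrightarrow> j < dim_vec v \<Longrightarrow> outer_prod u v $$ (i, j) = u $ i * v $ j"
  by (simp add: outer_prod_def)

lemma outer_prod_mult:
  assumes "dim_vec v = dim_vec w"
  shows "outer_prod u v * outer_prod w x = (v \<bullet> w) \<cdot>\<^sub>m outer_prod u x"
  by (rule eq_matI) (use assms in \<open>auto simp: scalar_prod_def sum_distrib_right intro!: sum.cong\<close>)

lemma outer_prod_mult_vec:
  assumes "dim_vec v = dim_vec w"
  shows "outer_prod u v *\<^sub>v w = (v \<bullet> w) \<cdot>\<^sub>v u"
  by (rule eq_vecI) (use assms in \<open>auto simp: scalar_prod_def sum_distrib_right intro!: sum.cong\<close>)

text \<open>The reflection in the hyperplane orthogonal to the difference of two unit vectors
  exchanges them. If they coincide, the identity serves instead.\<close>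

lemma householder_reflection:
  fixes v :: "real vec"
  assumes v: "v \<in> carrier_vec n" "v \<bullet> v = 1" and i: "i < n"
  obtains H where "H \<in> carrier_mat n n" "H\<^sup>T = H" "H * H = 1\<^sub>m n" "H *\<^sub>v unit_vec n i = v"
proof (cases "v = unit_vec n i")
  case True
  then show ?thesis by (intro that[of "1\<^sub>m n"]) auto
next
  case False
  define u where "u = unit_vec n i - v"
  have u: "u \<in> carrier_vec n" using v by (simp add: u_def)
  have [simp]: "dim_vec u = n" using u by simp
  have "u \<noteq> 0\<^sub>v n"
  proof
    assume "u = 0\<^sub>v n"
    then have "u $ j = 0" if "j < n" for j using that by simp
    then have "v $ j = unit_vec n i $ j" if "j < n" for j
      using that v unfolding u_def by fastforce
    then show False using False v by (auto simp: vec_eq_iff)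
  qed
  then have uu: "u \<bullet> u > 0" using conjugate_square_greater_0_vec[OF u] by simp
  \<comment> \<open>As \<open>u $ i\<close> is \<open>1 - v $ i\<close>, this says
    \<open>u \<bullet> u = 2 * u $ i\<close>. Hence \<open>c * u $ i = 1\<close>, and the reflection
    subtracts exactly \<open>u\<close> from the unit vector.\<close>
  have uu': "u \<bullet> u = 2 * (1 - v $ i)"
    using v i unfolding u_def
    by (simp add: minus_scalar_prod_distrib[of _ n] scalar_prod_minus_distrib[of _ n])
  define c where "c = 2 / (u \<bullet> u)"
  define H where "H = 1\<^sub>m n - c \<cdot>\<^sub>m outer_prod u u"
  have [simp]: "dim_row H = n" "dim_col H = n" by (simp_all add: H_def)
  have "H * H = (1\<^sub>m n - c \<cdot>\<^sub>m outer_prod u u) - c \<cdot>\<^sub>m (outer_prod u u - c \<cdot>\<^sub>m (outer_prod u u * outer_prod u u))"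
    unfolding H_def
    by (simp add: mat_dim_simps)
  also have "\<dots> = 1\<^sub>m n"
    using uu by (intro eq_matI) (auto simp: outer_prod_mult c_def)
  finally have HH: "H * H = 1\<^sub>m n" .
  have "c * u $ i = 1"
    using uu v i unfolding c_def uu' by (simp add: u_def)
  moreover have "H *\<^sub>v unit_vec n i = unit_vec n i - c \<cdot>\<^sub>v (u $ i \<cdot>\<^sub>v u)"
    unfolding H_def using i u
    by (intro eq_vecI) (auto simp: scalar_prod_right_unit)
  ultimately have "H *\<^sub>v unit_vec n i = v"
    using v i by (simp add: smult_smult_assoc u_def) (auto intro!: eq_vecI)
  moreover have "H\<^sup>T = H"
    unfolding H_def by (rule eq_matI) (auto simp: mult.commute)
  ultimately show ?thesis using that HH by (metis carrier_matI \<open>dim_row H = n\<close> \<open>dim_col H = n\<close>)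
qed

lemma mult_unit_vec_eq_col:
  fixes M :: "real mat"
  assumes "M \<in> carrier_mat m n" "i < n"
  shows "M *\<^sub>v unit_vec n i = col M i"
  using assms by (intro eq_vecI) (auto simp: scalar_prod_right_unit)

text \<open>An eigenvector that is the first unit vector fixes the first column, and symmetry then
  fixes the first row; the rest is the smaller symmetric matrix. The next lemma does the same at the
  other end of the basis.\<close>

lemma symmetric_deflate_first:
  fixes N :: "real mat"
  assumes N: "N \<in> carrier_mat (Suc n) (Suc n)" "N\<^sup>T = N"
    and e: "N *\<^sub>v unit_vec (Suc n) 0 = l \<cdot>\<^sub>v unit_vec (Suc n) 0"
  obtains N' where "N' \<in> carrier_mat n n" "N'\<^sup>T = N'" "N = block_diag (l \<cdot>\<^sub>m 1\<^sub>m 1) N'"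
proof
  define N' where "N' = mat n n (\<lambda>(i, j). N $$ (Suc i, Suc j))"
  have s: "N $$ (i, j) = N $$ (j, i)" if "i < Suc n" "j < Suc n" for i j
    using N that by (metis carrier_matD index_transpose_mat(1))
  have c: "N $$ (i, 0) = (if i = 0 then l else 0)" if "i < Suc n" for i
    using arg_cong[OF e, of "\<lambda>v. v $ i"] that mult_unit_vec_eq_col[OF N(1), of 0] N(1) by auto
  show "N' \<in> carrier_mat n n" by (simp add: N'_def)
  show "N'\<^sup>T = N'" unfolding N'_def by (rule eq_matI) (auto simp: s)
  show "N = block_diag (l \<cdot>\<^sub>m 1\<^sub>m 1) N'"
  proof (rule eq_matI)
    fix i j assume "i < dim_row (block_diag (l \<cdot>\<^sub>m 1\<^sub>m 1) N')" "j < dim_col (block_diag (l \<cdot>\<^sub>m 1\<^sub>m 1) N')"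
    then have "i < Suc n" "j < Suc n" by (auto simp: N'_def)
    then show "N $$ (i, j) = block_diag (l \<cdot>\<^sub>m 1\<^sub>m 1) N' $$ (i, j)"
      using c[of i] c[of j] s[of 0 j] by (auto simp: block_diag_def N'_def)
  qed (use N in \<open>auto simp: N'_def\<close>)
qed

lemma symmetric_deflate_last:
  fixes N :: "real mat"
  assumes N: "N \<in> carrier_mat (Suc n) (Suc n)" "N\<^sup>T = N"
    and e: "N *\<^sub>v unit_vec (Suc n) n = l \<cdot>\<^sub>v unit_vec (Suc n) n"
  obtains N' where "N' \<in> carrier_mat n n" "N'\<^sup>T = N'" "N = block_diag N' (l \<cdot>\<^sub>m 1\<^sub>m 1)"
proof
  define N' where "N' = mat n n (\<lambda>(i, j). N $$ (i, j))"
  have s: "N $$ (i, j) = N $$ (j, i)" if "i < Suc n" "j < Suc n" for i j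
    using N that by (metis carrier_matD index_transpose_mat(1))
  have c: "N $$ (i, n) = (if i = n then l else 0)" if "i < Suc n" for i
    using arg_cong[OF e, of "\<lambda>v. v $ i"] that mult_unit_vec_eq_col[OF N(1), of n] N(1) by auto
  show "N' \<in> carrier_mat n n" by (simp add: N'_def)
  show "N'\<^sup>T = N'" unfolding N'_def by (rule eq_matI) (auto simp: s)
  show "N = block_diag N' (l \<cdot>\<^sub>m 1\<^sub>m 1)"
  proof (rule eq_matI)
    fix i j assume "i < dim_row (block_diag N' (l \<cdot>\<^sub>m 1\<^sub>m 1))" "j < dim_col (block_diag N' (l \<cdot>\<^sub>m 1\<^sub>m 1))"
    then have "i < Suc n" "j < Suc n" by (auto simp: N'_def)
    then show "N $$ (i, j) = block_diag N' (l \<cdot>\<^sub>m 1\<^sub>m 1) $$ (i, j)"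
      using c[of i] c[of j] s[of n j] by (auto simp: block_diag_def N'_def less_Suc_eq)
  qed (use N in \<open>auto simp: N'_def\<close>)
qed

lemma orthogonal_square_mult:
  assumes "orthogonal_square n P" "orthogonal_square n Q"
  shows "orthogonal_square n (P * Q)"
proof -
  have P: "P \<in> carrier_mat n n" "P\<^sup>T * P = 1\<^sub>m n" "P * P\<^sup>T = 1\<^sub>m n"
    and Q: "Q \<in> carrier_mat n n" "Q\<^sup>T * Q = 1\<^sub>m n" "Q * Q\<^sup>T = 1\<^sub>m n"
    using assms by (auto simp: orthogonal_square_def)
  note [simp] = carrier_matD[OF P(1)] carrier_matD[OF Q(1)]
  have "P\<^sup>T * (P * Q) = Q" using mat_mult_left_cong[OF P(2)] by simp
  moreover have "Q * (Q\<^sup>T * P\<^sup>T) = P\<^sup>T" using mat_mult_left_cong[OF Q(3)] by simp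
  ultimately show ?thesis
    using P Q by (auto simp: orthogonal_square_def mat_dim_simps)
qed

lemma orthogonal_square_block_diag:
  assumes "orthogonal_square m P" "orthogonal_square n Q"
  shows "orthogonal_square (m + n) (block_diag P Q)"
  using assms unfolding orthogonal_square_def
  by (auto simp: block_diag_transpose block_diag_mult block_diag_one intro!: carrier_matI)

lemma orthogonal_square_one: "orthogonal_square n (1\<^sub>m n)"
  by (simp add: orthogonal_square_def)

text \<open>The eigenvector found in each step is reflected to the front of the basis when its eigenvalue is
  nonzero and to the back otherwise, which keeps the zero eigenvalues in the last block.\<close>

lemma real_symmetric_diagonalization:
  fixes M :: "real mat"
  assumes "M \<in> carrier_mat n n" "M\<^sup>T = M"
  shows "\<exists>Q r D. r \<le> n \<and> orthogonal_square n Q \<and> D \<in> carrier_mat r r \<and> diagonal_mat D \<and>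
    (\<forall>i<r. D $$ (i, i) \<noteq> 0) \<and> M = Q * block_diag D (0\<^sub>m (n - r) (n - r)) * Q\<^sup>T"
  using assms
proof (induction n arbitrary: M)
  case 0
  then show ?case
    by (intro exI[of _ "1\<^sub>m 0"] exI[of _ 0] exI[of _ "1\<^sub>m 0"])
      (auto simp: orthogonal_square_one diagonal_mat_def block_diag_def)
next
  case (Suc n)
  obtain l v where v: "v \<in> carrier_vec (Suc n)" "v \<bullet> v = 1" "M *\<^sub>v v = l \<cdot>\<^sub>v v"
    using real_symmetric_eigenvector[OF Suc.prems] by blast
  \<comment> \<open>A reflection is its own inverse, so \<open>H * M * H\<close> is an orthogonal
    conjugate of \<open>M\<close> with a unit vector as eigenvector for \<open>l\<close>. The
    position \<open>i\<close> stays open, since the two cases below use the first and the last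
    index.\<close>
  have reflect: "\<exists>H. H \<in> carrier_mat (Suc n) (Suc n) \<and> H\<^sup>T = H \<and> orthogonal_square (Suc n) H \<and>
      H * M * H \<in> carrier_mat (Suc n) (Suc n) \<and> (H * M * H)\<^sup>T = H * M * H \<and> M = H * (H * M * H) * H\<^sup>T \<and>
      (H * M * H) *\<^sub>v unit_vec (Suc n) i = l \<cdot>\<^sub>v unit_vec (Suc n) i" if i: "i < Suc n" for i
  proof -
    obtain H where H: "H \<in> carrier_mat (Suc n) (Suc n)" "H\<^sup>T = H" "H * H = 1\<^sub>m (Suc n)"
      "H *\<^sub>v unit_vec (Suc n) i = v"
      using householder_reflection[OF v(1,2) i] by blast
    note [simp] = carrier_matD[OF H(1)] carrier_matD[OF Suc.prems(1)]
    have HHX: "H * (H * X) = X" if "dim_row X = Suc n" for X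
      using mat_mult_left_cong[OF H(3)] that by simp
    have "(H * M * H) *\<^sub>v unit_vec (Suc n) i = H *\<^sub>v (M *\<^sub>v v)"
      using H Suc.prems v
      by (simp add: assoc_mult_mat_vec[of _ "Suc n" "Suc n" _ "Suc n"] assoc_mult_mat_vec[of _ "Suc n" "Suc n" H "Suc n"] mat_dim_simps)
    also have "\<dots> = l \<cdot>\<^sub>v (H *\<^sub>v (H *\<^sub>v unit_vec (Suc n) i))"
      unfolding v(3) H(4) using H v by (simp add: mult_mat_vec[of _ "Suc n" "Suc n"])
    also have "H *\<^sub>v (H *\<^sub>v unit_vec (Suc n) i) = unit_vec (Suc n) i"
      using H(1,3) by (metis assoc_mult_mat_vec one_mult_mat_vec unit_vec_carrier)
    finally show ?thesis using H Suc.prems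
      by (intro exI[of _ H]) (auto simp: orthogonal_square_def mat_dim_simps HHX)
  qed
  show ?case
  proof (cases "l = 0")
    case False
    obtain H where H: "H \<in> carrier_mat (Suc n) (Suc n)" "H\<^sup>T = H" "orthogonal_square (Suc n) H"
      and N: "H * M * H \<in> carrier_mat (Suc n) (Suc n)" "(H * M * H)\<^sup>T = H * M * H"
        "(H * M * H) *\<^sub>v unit_vec (Suc n) 0 = l \<cdot>\<^sub>v unit_vec (Suc n) 0"
      and M: "M = H * (H * M * H) * H\<^sup>T"
      using reflect[of 0] by auto
    obtain N' where N': "N' \<in> carrier_mat n n" "N'\<^sup>T = N'" "H * M * H = block_diag (l \<cdot>\<^sub>m 1\<^sub>m 1) N'"
      using symmetric_deflate_first[OF N] by blast
    obtain Q r D where IH: "r \<le> n" "orthogonal_square n Q" "D \<in> carrier_mat r r" "diagonal_mat D"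
      "\<And>i. i < r \<Longrightarrow> D $$ (i, i) \<noteq> 0" "N' = Q * block_diag D (0\<^sub>m (n - r) (n - r)) * Q\<^sup>T"
      using Suc.IH[OF N'(1,2)] by auto
    have Q: "Q \<in> carrier_mat n n" using IH by (simp add: orthogonal_square_def)
    note [simp] = carrier_matD[OF H(1)] carrier_matD[OF Q] carrier_matD[OF IH(3)]
    \<comment> \<open>The nonzero eigenvalue joins the invertible part, which grows from
      \<open>r\<close> to \<open>Suc r\<close>; the trailing zero block keeps its size
      \<open>n - r\<close>.\<close>
    define D' where "D' = block_diag (l \<cdot>\<^sub>m 1\<^sub>m 1) D"
    define R where "R = block_diag (1\<^sub>m 1) Q"
    have R: "dim_row R = Suc n" "dim_col R = Suc n" by (simp_all add: R_def)
    have "block_diag (l \<cdot>\<^sub>m 1\<^sub>m 1) N' = R * block_diag D' (0\<^sub>m (n - r) (n - r)) * R\<^sup>T"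
      using IH(1) by (simp add: R_def D'_def block_diag_transpose block_diag_mult IH(6)
          block_diag_assoc[symmetric])
    then have "M = (H * R) * block_diag D' (0\<^sub>m (Suc n - Suc r) (Suc n - Suc r)) * (H * R)\<^sup>T"
      using M IH(1) unfolding N'(3) by (simp add: mat_dim_simps R D'_def)
    moreover have "orthogonal_square (Suc n) (H * R)"
      using orthogonal_square_block_diag[OF orthogonal_square_one[of 1] IH(2)] H(3)
      by (auto simp: R_def intro: orthogonal_square_mult)
    moreover have "diagonal_mat D'" "\<forall>i<Suc r. D' $$ (i, i) \<noteq> 0"
      using IH(4,5) False by (auto simp: D'_def block_diag_def diagonal_mat_def less_Suc_eq_0_disj) blast
    moreover have "D' \<in> carrier_mat (Suc r) (Suc r)" by (auto simp: D'_def intro!: carrier_matI)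
    ultimately show ?thesis using IH(1) by (intro exI[of _ "H * R"] exI[of _ "Suc r"] exI[of _ D']) auto
  next
    case True
    obtain H where H: "H \<in> carrier_mat (Suc n) (Suc n)" "H\<^sup>T = H" "orthogonal_square (Suc n) H"
      and N: "H * M * H \<in> carrier_mat (Suc n) (Suc n)" "(H * M * H)\<^sup>T = H * M * H"
        "(H * M * H) *\<^sub>v unit_vec (Suc n) n = l \<cdot>\<^sub>v unit_vec (Suc n) n"
      and M: "M = H * (H * M * H) * H\<^sup>T"
      using reflect[of n] by auto
    obtain N' where N': "N' \<in> carrier_mat n n" "N'\<^sup>T = N'" "H * M * H = block_diag N' (l \<cdot>\<^sub>m 1\<^sub>m 1)"
      using symmetric_deflate_last[OF N] by blast
    obtain Q r D where IH: "r \<le> n" "orthogonal_square n Q" "D \<in> carrier_mat r r" "diagonal_mat D"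
      "\<And>i. i < r \<Longrightarrow> D $$ (i, i) \<noteq> 0" "N' = Q * block_diag D (0\<^sub>m (n - r) (n - r)) * Q\<^sup>T"
      using Suc.IH[OF N'(1,2)] by auto
    have Q: "Q \<in> carrier_mat n n" using IH by (simp add: orthogonal_square_def)
    note [simp] = carrier_matD[OF H(1)] carrier_matD[OF Q] carrier_matD[OF IH(3)]
    define R where "R = block_diag Q (1\<^sub>m 1)"
    have R: "dim_row R = Suc n" "dim_col R = Suc n" by (simp_all add: R_def)
    have zero: "l \<cdot>\<^sub>m 1\<^sub>m 1 = 0\<^sub>m 1 1" using True by (intro eq_matI) auto
    \<comment> \<open>Here \<open>r\<close> and \<open>D\<close> are kept, and the zero eigenvalue
      enlarges the trailing zero block by one.\<close>
    have zeros: "block_diag D (0\<^sub>m (Suc n - r) (Suc n - r))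
        = block_diag (block_diag D (0\<^sub>m (n - r) (n - r))) (0\<^sub>m 1 1)"
      using IH(1) by (simp add: block_diag_assoc[symmetric] block_diag_zero Suc_diff_le)
    have "block_diag N' (l \<cdot>\<^sub>m 1\<^sub>m 1) = R * block_diag D (0\<^sub>m (Suc n - r) (Suc n - r)) * R\<^sup>T"
      unfolding zeros zero using IH(1) by (simp add: R_def block_diag_transpose block_diag_mult IH(6))
    then have MHR: "M = (H * R) * block_diag D (0\<^sub>m (Suc n - r) (Suc n - r)) * (H * R)\<^sup>T"
      using M IH(1) unfolding N'(3) by (simp add: mat_dim_simps R)
    have HR: "orthogonal_square (Suc n) (H * R)"
      using orthogonal_square_block_diag[OF IH(2) orthogonal_square_one[of 1]] H(3)
      by (auto simp: R_def intro: orthogonal_square_mult)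
    have "r \<le> Suc n" "\<forall>i<r. D $$ (i, i) \<noteq> 0" using IH(1,5) by simp_all
    then show ?thesis using MHR HR IH(3,4) by blast
  qed
qed

lemma diagonal_mat_mult_vec_eq_zero:
  fixes D :: "real mat"
  assumes D: "D \<in> carrier_mat n n" "diagonal_mat D" "\<And>i. i < n \<Longrightarrow> D $$ (i, i) \<noteq> 0"
    and v: "v \<in> carrier_vec n" "D *\<^sub>v v = 0\<^sub>v n"
  shows "v = 0\<^sub>v n"
proof (rule eq_vecI)
  fix i assume "i < dim_vec (0\<^sub>v n :: real vec)"
  then have i: "i < n" by simp
  have "0 = (D *\<^sub>v v) $ i" using v i by simp
  also have "\<dots> = (\<Sum>j = 0..<n. D $$ (i, j) * v $ j)"
    using D(1) v(1) i by (auto simp: scalar_prod_def)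
  also have "\<dots> = (\<Sum>j = 0..<n. if j = i then D $$ (i, i) * v $ i else 0)"
    using D(1,2) i by (intro sum.cong) (auto simp: diagonal_mat_def)
  also have "\<dots> = D $$ (i, i) * v $ i" using i by simp
  finally show "v $ i = 0\<^sub>v n $ i" using D(3)[OF i] i by simp
qed (use v in auto)

text \<open>\<open>D\<close> is the compression \<open>U\<^sup>T * M * U\<close>, hence positive
  semidefinite. The additional conclusion \<open>det D \<noteq> 0\<close> excludes zero eigenvalues
  from \<open>D\<close>; it later yields the bound on the number of columns of \<open>U\<close> and
  an inverse on the range.\<close>

lemma orth_diagonalization_exists:
  assumes M: "psd M" "M \<in> carrier_mat n n"
  obtains r U W D where "orth_diagonalization n r M U W D" "det D \<noteq> 0"
proof -
  obtain Q r D where Q: "r \<le> n" "orthogonal_square n Q" and D: "D \<in> carrier_mat r r" "diagonal_mat D"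
    "\<And>i. i < r \<Longrightarrow> D $$ (i, i) \<noteq> 0" and MQ: "M = Q * block_diag D (0\<^sub>m (n - r) (n - r)) * Q\<^sup>T"
    using real_symmetric_diagonalization[OF M(2)] M psd_iff by blast
  have "Q \<in> carrier_mat n (r + (n - r))" using Q by (simp add: orthogonal_square_def)
  then obtain U W where U: "U \<in> carrier_mat n r" and W: "W \<in> carrier_mat n (n - r)" and QUW: "Q = append_cols U W"
    by (rule append_cols_split)
  note [simp] = carrier_matD[OF U] carrier_matD[OF W] carrier_matD[OF D(1)]
  note orth = orthogonal_append_colsD[OF Q(2)[unfolded QUW] U W]
  have "M = U * D * U\<^sup>T" using MQ QUW append_cols_compact_form[OF U W D(1)] by simp
  then have "U\<^sup>T * M * U = (U\<^sup>T * U) * D * (U\<^sup>T * U)" by (simp add: mat_dim_simps)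
  then have "psd D" using psd_congruence[OF M U] orth(2) by simp
  then have "orth_diagonalization n r M U W D"
    using Q D U W MQ
    by (auto simp: orth_diagonalization_def QUW diag_block_mat_two simp del: diag_block_mat.simps)
  moreover have "det D \<noteq> 0"
    using det_0_iff_vec_prod_zero[OF D(1)] diagonal_mat_mult_vec_eq_zero[OF D] by blast
  ultimately show ?thesis using that by blast
qed

section \<open>Rank, kernel and range of products and Gram matrices\<close>

lemma (in vec_space) rank_mult_le:
  assumes A: "A \<in> carrier_mat n k" and B: "B \<in> carrier_mat k m"
  shows "rank (A * B) \<le> k"
proof -
  have AB: "A * B \<in> carrier_mat n m" using A B by simp
  \<comment> \<open>The product maps into the column space of \<open>A\<close>, whose dimension is
    at most its number \<open>k\<close> of columns.\<close>
  have sub: "span (set (cols (A * B))) \<subseteq> span (set (cols A))"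
  proof -
    have "col_space (A * B) \<subseteq> col_space A"
      unfolding col_space_eq[OF AB] col_space_eq[OF A]
      using A B by (auto simp: assoc_mult_mat_vec[of _ n k _ m])
    then show ?thesis by (simp add: col_space_def)
  qed
  have s1: "VectorSpace.subspace class_ring (span (set (cols A))) V"
    and s2: "VectorSpace.subspace class_ring (span (set (cols (A * B)))) V"
    using A AB by (metis cols_dim carrier_matD(1) span_is_subspace)+
  have "rank (A * B) \<le> rank A"
    unfolding rank_def
    using vectorspace.subspace_dim[OF subspace_is_vs[OF s1] nested_subspaces[OF s1 s2 sub]]
      fin_dim_span_cols[OF A] fin_dim_span_cols[OF AB] by simp
  then show ?thesis using rank_le_nc[OF A] by simp
qed

text \<open>Multiplying the hypothesis by \<open>W\<^sup>T\<close> on the left makes the Gram matrix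
  of the columns of \<open>F\<^sup>T * W\<close> vanish; the kernel lemma for the identity matrix
  then makes these columns zero.\<close>

lemma gram_kernel:
  fixes F W :: "real mat"
  assumes F: "F \<in> carrier_mat n r" and W: "W \<in> carrier_mat n k"
    and zero: "F * F\<^sup>T * W = 0\<^sub>m n k"
  shows "F\<^sup>T * W = 0\<^sub>m r k"
proof -
  note [simp] = carrier_matD[OF F] carrier_matD[OF W]
  have "F * (F\<^sup>T * W) = 0\<^sub>m n k" using zero by (simp add: mat_dim_simps)
  then have "(F\<^sup>T * W)\<^sup>T * 1\<^sub>m r * (F\<^sup>T * W) = 0\<^sub>m k k" by (simp add: mat_dim_simps)
  then have "1\<^sub>m r * (F\<^sup>T * W) = 0\<^sub>m r k"
    by (intro psd_kernel_mat[OF psd_one]) (use F W in auto)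
  then show ?thesis by simp
qed

lemma matrix_inverse_obtain:
  fixes D :: "real mat"
  assumes "D \<in> carrier_mat n n" "det D \<noteq> 0"
  obtains D' where "mat_inverse D = Some D'" "D' \<in> carrier_mat n n" "D * D' = 1\<^sub>m n" "D' * D = 1\<^sub>m n"
proof -
  obtain D' where D': "mat_inverse D = Some D'"
    using mat_inverse(1)[OF assms(1), where b = "()"] det_non_zero_imp_unit[OF assms, where b = "()"]
    by (cases "mat_inverse D") auto
  show ?thesis using mat_inverse(2)[OF assms(1) D'] D' that by blast
qed

text \<open>The columns of \<open>W\<close> span a complement on which \<open>F\<^sup>T\<close>
  vanishes, so \<open>U * U\<^sup>T\<close> fixes \<open>F\<close>. On the range of \<open>U\<close>
  the Gram matrix can be inverted, which solves \<open>F * F\<^sup>T * G = F\<close>.\<close>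

lemma gram_col_space:
  fixes F :: "real mat"
  assumes F: "F \<in> carrier_mat m r" and x: "x \<in> carrier_vec r"
  shows "F *\<^sub>v x \<in> vec_space.col_space m (F * F\<^sup>T)"
proof -
  have FF: "F * F\<^sup>T \<in> carrier_mat m m" using F by simp
  obtain s U W D where D: "orth_diagonalization m s (F * F\<^sup>T) U W D" "det D \<noteq> 0"
    using orth_diagonalization_exists[OF psd_gram FF] by blast
  note o = orth_diagonalizationD[OF D(1)]
  note [simp] = carrier_matD[OF F] carrier_matD[OF o(2)] carrier_matD[OF o(3)] carrier_matD[OF o(4)]
  obtain D' where D': "D' \<in> carrier_mat s s" "D * D' = 1\<^sub>m s"
    using matrix_inverse_obtain[OF o(4) D(2)] by blast
  note [simp] = carrier_matD[OF D'(1)]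
  have "(F\<^sup>T * W)\<^sup>T = (0\<^sub>m r (m - s))\<^sup>T" using gram_kernel[OF F o(3) o(8)] by simp
  then have WF: "W\<^sup>T * F = 0\<^sub>m (m - s) r" by (simp add: mat_dim_simps)
  have "F = (U * U\<^sup>T + W * W\<^sup>T) * F" unfolding o(6) by simp
  also have "\<dots> = U * (U\<^sup>T * F)" using F o(2) by (simp add: mat_dim_simps WF)
  finally have FU: "F = U * (U\<^sup>T * F)" .
  \<comment> \<open>The factor \<open>U * D' * U\<^sup>T\<close> is the Moore-Penrose inverse of
    \<open>F * F\<^sup>T\<close>, applied here to \<open>F\<close>.\<close>
  define G where "G = U * D' * (U\<^sup>T * F)"
  have G: "G \<in> carrier_mat m r" by (auto simp: G_def intro!: carrier_matI)
  have "F * F\<^sup>T * G = U * (D * ((U\<^sup>T * U) * (D' * (U\<^sup>T * F))))"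
    unfolding o(7) G_def by (simp add: mat_dim_simps)
  also have "\<dots> = U * ((D * D') * (U\<^sup>T * F))" unfolding o(5) by (simp add: mat_dim_simps)
  also have "\<dots> = F" unfolding D' using FU by simp
  finally have "F * F\<^sup>T * G = F" .
  then have "F *\<^sub>v x = F * F\<^sup>T *\<^sub>v (G *\<^sub>v x)"
    using assoc_mult_mat_vec[OF FF G x] by simp
  moreover have "G *\<^sub>v x \<in> carrier_vec m" using G x by auto
  ultimately show ?thesis
    unfolding vec_space.col_space_eq[OF FF] using F x by auto
qed

section \<open>Euclidean distance matrices\<close>

lemma ones_vec_dim [simp]: "dim_vec (ones_vec k) = k" by (simp add: ones_vec_def)

lemma ones_vec_index [simp]: "i < k \<Longrightarrow> ones_vec k $ i = 1" by (simp add: ones_vec_def)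

lemma ones_vec_carrier [simp]: "ones_vec k \<in> carrier_vec k" by (simp add: ones_vec_def)

lemma edm_K_dim [simp]: "dim_row (edm_K B) = dim_row B" "dim_col (edm_K B) = dim_col B"
  by (simp_all add: edm_K_def)

lemma diag_of_index [simp]: "i < dim_row B \<Longrightarrow> diag_of B $ i = B $$ (i, i)"
  by (simp add: diag_of_def diag_mat_def vec_of_list_index)

lemma diag_of_dim [simp]: "dim_vec (diag_of B) = dim_row B"
  by (simp add: diag_of_def diag_mat_def)

lemma edm_K_index:
  assumes "B \<in> carrier_mat k k" "i < k" "j < k"
  shows "edm_K B $$ (i, j) = B $$ (i, i) + B $$ (j, j) - 2 * B $$ (i, j)"
  using assms by (simp add: edm_K_def)

lemma off_diag_edm_K:
  assumes "B \<in> carrier_mat k k"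
  shows "off_diag (edm_K B) = edm_K B"
  using assms by (intro eq_matI) (auto simp: off_diag_def edm_K_index)

lemma mat_mult_outer_prod:
  fixes A :: "real mat"
  assumes "dim_col A = dim_vec u"
  shows "A * outer_prod u v = outer_prod (A *\<^sub>v u) v"
  by (rule eq_matI) (use assms in \<open>auto simp: scalar_prod_def sum_distrib_right mult.assoc intro!: sum.cong\<close>)

lemma outer_prod_mult_mat:
  fixes A :: "real mat"
  assumes "dim_row A = dim_vec v"
  shows "outer_prod u v * A = outer_prod u (A\<^sup>T *\<^sub>v v)"
  by (rule eq_matI) (use assms in \<open>auto simp: scalar_prod_def sum_distrib_left mult_ac intro!: sum.cong\<close>)

lemma centering_carrier [simp]: "centering k \<in> carrier_mat k k"
  by (simp add: centering_def carrier_matI)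

lemma centering_dim [simp]: "dim_row (centering k) = k" "dim_col (centering k) = k"
  using centering_carrier[of k] by (auto simp del: centering_carrier)

lemma centering_transpose [simp]: "(centering k)\<^sup>T = centering k"
  by (rule eq_matI) (auto simp: centering_def)

lemma centering_mult_vec:
  assumes "x \<in> carrier_vec k"
  shows "centering k *\<^sub>v x = x - (1 / k * (ones_vec k \<bullet> x)) \<cdot>\<^sub>v ones_vec k"
proof -
  have "centering k *\<^sub>v x = x - (1 / k) \<cdot>\<^sub>v (outer_prod (ones_vec k) (ones_vec k) *\<^sub>v x)"
    unfolding centering_def using assms
    by (subst minus_mult_distrib_mat_vec[of _ k k]) (auto intro!: carrier_matI eq_vecI)
  also have "outer_prod (ones_vec k) (ones_vec k) *\<^sub>v x = (ones_vec k \<bullet> x) \<cdot>\<^sub>v ones_vec k"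
    using assms by (simp add: outer_prod_mult_vec)
  finally show ?thesis by (simp add: smult_smult_assoc)
qed

lemma ones_vec_sprod_self: "ones_vec k \<bullet> ones_vec k = real k"
  by (simp add: scalar_prod_def)

lemma centering_ones: "centering k *\<^sub>v ones_vec k = 0\<^sub>v k"
  by (simp add: centering_mult_vec ones_vec_sprod_self) (auto intro!: eq_vecI)

text \<open>The two rank-one terms of \<open>edm_K\<close> contain the vector of ones, which the
  centering matrix annihilates. The factor \<open>-1/2\<close> cancels the remaining
  \<open>-2\<close>.\<close>

lemma centering_edm_K:
  assumes G: "G \<in> carrier_mat k k"
  shows "edm_K_pinv (edm_K G) = centering k * G * centering k"
proof -
  note [simp] = carrier_matD[OF G]
  let ?J = "centering k" let ?e = "ones_vec k" let ?d = "diag_of G"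
  have z: "outer_prod (0\<^sub>v k) u = 0\<^sub>m k (dim_vec u)" "outer_prod u (0\<^sub>v k) = 0\<^sub>m (dim_vec u) k" for u
    by (auto intro!: eq_matI)
  have "?J * edm_K G * ?J = (0\<^sub>m k k + 0\<^sub>m k k) - 2 \<cdot>\<^sub>m (?J * (G * ?J))"
    unfolding edm_K_def
    by (simp add: mat_dim_simps mat_mult_outer_prod outer_prod_mult_mat centering_ones z)
  then show ?thesis
    unfolding edm_K_pinv_def off_diag_edm_K[OF G]
    by (simp add: mat_dim_simps) (auto intro!: eq_matI)
qed

text \<open>Expanding the two centerings removes \<open>g\<close> times ones from rows and columns
  and adds back a multiple of the all-ones matrix. Splitting that multiple evenly between the two
  rank-one terms gives \<open>y = g - (e \<bullet> g) / (2 k) e\<close>, written here as a centered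
  vector plus a multiple of the ones vector \<open>e\<close>.\<close>

lemma double_centering:
  assumes G: "G \<in> carrier_mat k k" "G\<^sup>T = G" and k: "k > 0"
  defines "g \<equiv> (1 / k) \<cdot>\<^sub>v (G *\<^sub>v ones_vec k)"
  defines "y \<equiv> centering k *\<^sub>v g + (1 / (2 * real k) * (ones_vec k \<bullet> g)) \<cdot>\<^sub>v ones_vec k"
  shows "G = centering k * G * centering k + outer_prod y (ones_vec k) + outer_prod (ones_vec k) y"
proof -
  note [simp] = carrier_matD[OF G(1)]
  let ?e = "ones_vec k"
  have g: "g \<in> carrier_vec k" using G by (auto simp: g_def)
  have [simp]: "dim_vec g = k" using g by simp
  have Ge: "G *\<^sub>v ?e = real k \<cdot>\<^sub>v g" using k by (simp add: g_def smult_smult_assoc)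
  have kge: "(real k \<cdot>\<^sub>v g) \<bullet> ?e = k * (?e \<bullet> g)"
    using g by (simp add: comm_scalar_prod[of ?e k g])
  have "centering k * G * centering k
      = (G - outer_prod g ?e) - (outer_prod ?e g - (1 / k * (?e \<bullet> g)) \<cdot>\<^sub>m outer_prod ?e ?e)"
  proof -
    \<comment> \<open>By symmetry of \<open>G\<close>, \<open>G - ?R\<close> equals
      \<open>centering k * G\<close>: the left centering is carried out first.\<close>
    let ?R = "(1 / k) \<cdot>\<^sub>m outer_prod ?e (real k \<cdot>\<^sub>v g)"
    have "(G - ?R) *\<^sub>v ?e = real k \<cdot>\<^sub>v g - (1 / k) \<cdot>\<^sub>v (outer_prod ?e (real k \<cdot>\<^sub>v g) *\<^sub>v ?e)"
      using G(1) Ge by (subst minus_mult_distrib_mat_vec[of _ k k]) (auto intro!: carrier_matI eq_vecI)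
    also have "\<dots> = real k \<cdot>\<^sub>v g - (?e \<bullet> g) \<cdot>\<^sub>v ?e"
      using k by (simp add: outer_prod_mult_vec kge smult_smult_assoc del: scalar_prod_smult_left)
    finally have Re: "(G - ?R) *\<^sub>v ?e = real k \<cdot>\<^sub>v g - (?e \<bullet> g) \<cdot>\<^sub>v ?e" .
    have "centering k * G * centering k
        = (G - ?R) - (1 / k) \<cdot>\<^sub>m outer_prod ((G - ?R) *\<^sub>v ?e) ?e"
      unfolding centering_def
      by (simp add: mat_dim_simps mat_mult_outer_prod outer_prod_mult_mat G(2) Ge)
    also have "\<dots> = (G - ?R) - (1 / k) \<cdot>\<^sub>m outer_prod (real k \<cdot>\<^sub>v g - (?e \<bullet> g) \<cdot>\<^sub>v ?e) ?e"
      unfolding Re ..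
    also have "\<dots> = (G - outer_prod g ?e) - (outer_prod ?e g - (1 / k * (?e \<bullet> g)) \<cdot>\<^sub>m outer_prod ?e ?e)"
      using k by (intro eq_matI) (auto simp: field_simps)
    finally show ?thesis .
  qed
  moreover have "y = g - (1 / (2 * real k) * (?e \<bullet> g)) \<cdot>\<^sub>v ?e"
    unfolding y_def centering_mult_vec[OF g] using k by (intro eq_vecI) (auto simp: field_simps)
  ultimately show ?thesis
    using k by (intro eq_matI) (auto simp: field_simps)
qed

section \<open>Faces of the semidefinite cone\<close>

lemma pick_interval:
  assumes "i < b - a"
  shows "pick {a..<b} i = a + i"
proof -
  have "{x \<in> {a..<b}. x < a + i} = {a..<a + i}" using assms by auto
  then show ?thesis using pick_card_in_set[of "a + i" "{a..<b}"] assms by simp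
qed

lemma submatrix_interval:
  assumes "M \<in> carrier_mat N N'" "b \<le> N" "d \<le> N'"
  shows "submatrix M {a..<b} {c..<d} = mat (b - a) (d - c) (\<lambda>(i, j). M $$ (a + i, c + j))"
proof -
  have "{i. i < N \<and> i \<in> {a..<b}} = {a..<b}" "{i. i < N' \<and> i \<in> {c..<d}} = {c..<d}"
    using assms by auto
  then show ?thesis
    using assms(1) unfolding submatrix_def by (intro eq_matI) (auto simp: pick_interval)
qed

text \<open>The columns are the consecutive unit vectors starting at index \<open>a\<close>.
  Expressing submatrices as products with this matrix turns conditions on blocks into congruences,
  to which the kernel lemma for positive semidefinite matrices applies.\<close>

definition row_selector :: "nat \<Rightarrow> nat \<Rightarrow> nat \<Rightarrow> real mat" where
  "row_selector N a k = mat N k (\<lambda>(i, j). if i = a + j then 1 else 0)"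

lemma row_selector_dim [simp]: "dim_row (row_selector N a k) = N" "dim_col (row_selector N a k) = k"
  by (simp_all add: row_selector_def)

lemma row_selector_carrier [simp]: "row_selector N a k \<in> carrier_mat N k"
  by (simp add: row_selector_def)

lemma row_selector_transpose_mult:
  assumes "M \<in> carrier_mat N c" "a + k \<le> N"
  shows "(row_selector N a k)\<^sup>T * M = mat k c (\<lambda>(i, j). M $$ (a + i, j))"
proof (rule eq_matI)
  fix i j assume "i < dim_row (mat k c (\<lambda>(i, j). M $$ (a + i, j)))"
    "j < dim_col (mat k c (\<lambda>(i, j). M $$ (a + i, j)))"
  then have ij: "i < k" "j < c" by auto
  have "((row_selector N a k)\<^sup>T * M) $$ (i, j)
      = (\<Sum>l = 0..<N. (if l = a + i then 1 else 0) * M $$ (l, j))"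
    using ij assms by (auto simp: row_selector_def scalar_prod_def intro!: sum.cong)
  also have "\<dots> = (\<Sum>l = 0..<N. if l = a + i then M $$ (a + i, j) else 0)"
    by (intro sum.cong) auto
  also have "\<dots> = M $$ (a + i, j)" using ij assms by simp
  finally show "((row_selector N a k)\<^sup>T * M) $$ (i, j) = mat k c (\<lambda>(i, j). M $$ (a + i, j)) $$ (i, j)"
    using ij by simp
qed (use assms in auto)

lemma submatrix_rows_eq:
  assumes "M \<in> carrier_mat N c" "b \<le> N" "a \<le> b"
  shows "submatrix M {a..<b} {0..<c} = (row_selector N a (b - a))\<^sup>T * M"
  unfolding submatrix_interval[OF assms(1,2) order_refl]
  by (subst row_selector_transpose_mult[OF assms(1)]) (use assms in \<open>auto intro!: eq_matI\<close>)

lemma submatrix_block_eq: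
  assumes M: "M \<in> carrier_mat N N" and "b \<le> N" "a \<le> b"
  shows "submatrix M {a..<b} {a..<b} = (row_selector N a (b - a))\<^sup>T * M * row_selector N a (b - a)"
proof -
  let ?R = "row_selector N a (b - a)"
  note [simp] = carrier_matD[OF M]
  have 1: "?R\<^sup>T * M = mat (b - a) N (\<lambda>(i, j). M $$ (a + i, j))"
    using assms by (intro row_selector_transpose_mult) auto
  \<comment> \<open>Columns are selected by extracting rows of the transpose.\<close>
  have "(?R\<^sup>T * M * ?R)\<^sup>T = ?R\<^sup>T * (?R\<^sup>T * M)\<^sup>T" by (simp add: mat_transpose_mult_dim)
  also have "\<dots> = mat (b - a) (b - a) (\<lambda>(i, j). (?R\<^sup>T * M)\<^sup>T $$ (a + i, j))"
    using assms by (intro row_selector_transpose_mult) (auto intro!: carrier_matI)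
  also have "\<dots> = (submatrix M {a..<b} {a..<b})\<^sup>T"
    unfolding submatrix_interval[OF M assms(2,2)] 1 using assms by (intro eq_matI) auto
  finally show ?thesis by (metis transpose_transpose)
qed

lemma row_selector_last: "row_selector (n + m) n m = 0\<^sub>m n m @\<^sub>r 1\<^sub>m m"
  by (rule eq_matI) (auto simp: row_selector_def append_rows_def)

lemma row_selector_middle: "row_selector (t + k + m) t k = (0\<^sub>m t k @\<^sub>r 1\<^sub>m k) @\<^sub>r 0\<^sub>m m k"
  by (rule eq_matI) (auto simp: row_selector_def append_rows_def)

lemma append_rows_mult_transpose:
  fixes A B C D :: "real mat"
  assumes "dim_col A = dim_col B" "dim_col A = dim_col C" "dim_col A = dim_col D"
  shows "(A @\<^sub>r B) * (C @\<^sub>r D)\<^sup>T = four_block_mat (A * C\<^sup>T) (A * D\<^sup>T) (B * C\<^sup>T) (B * D\<^sup>T)"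
proof -
  have 1: "(C @\<^sub>r D)\<^sup>T = four_block_mat C\<^sup>T D\<^sup>T (0\<^sub>m 0 (dim_row C)) (0\<^sub>m 0 (dim_row D))"
    unfolding append_rows_def
    by (subst transpose_four_block_mat[of _ "dim_row C" "dim_col C" _ 0 _ "dim_row D"]) (use assms in auto)
  show ?thesis
    unfolding 1 unfolding append_rows_def
    by (subst mult_four_block_mat[of _ "dim_row A" "dim_col A" _ 0 _ "dim_row B" _ _ "dim_row C" _ "dim_row D"])
      (use assms in auto)
qed

lemma block_diag_mult_row_selector:
  assumes D: "D \<in> carrier_mat n p" and T: "T \<in> carrier_mat m r"
  shows "block_diag D T * row_selector (p + r) p r = row_selector (n + m) n m * T"
  using D T by (simp add: row_selector_last block_diag_mult_append_rows append_rows_mult)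

text \<open>\<open>S\<close> selects the anchor coordinates of \<open>Z\<close>, so that \<open>Z S\<close> is its last block column; the two descriptions
  of the feasible set differ only in \<open>D\<close>, the prescribed anchor block \<open>C\<close> and the factor \<open>R\<close>.\<close>

definition face_image :: "real mat \<Rightarrow> real mat \<Rightarrow> real mat \<Rightarrow> real mat \<Rightarrow> (real mat \<times> real mat) set" where
  "face_image D S C R = {(P, Y). \<exists>Z \<in> carrier_mat (dim_col D) (dim_col D).
     psd Z \<and> S\<^sup>T * Z * S = C \<and> Y = D * Z * D\<^sup>T \<and> P = D * Z * S * R}"

lemma mem_face_image_iff:
  assumes "D \<in> carrier_mat M N"
  shows "(P, Y) \<in> face_image D S C R \<longleftrightarrow> (\<exists>Z \<in> carrier_mat N N.
    psd Z \<and> S\<^sup>T * Z * S = C \<and> Y = D * Z * D\<^sup>T \<and> P = D * Z * S * R)"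
  using assms by (simp add: face_image_def)

text \<open>The anchor block is split off first, then the remaining square block; at each stage
  symmetry makes the upper block the transpose of the lower one.\<close>

lemma sym_block3_split:
  assumes Z: "Z \<in> carrier_mat (t + r2 + r) (t + r2 + r)" and sym: "Z\<^sup>T = Z"
  obtains Z11 Z21 Z22 Z31 Z32 Z33 where
    "Z11 \<in> carrier_mat t t" "Z21 \<in> carrier_mat r2 t" "Z22 \<in> carrier_mat r2 r2"
    "Z31 \<in> carrier_mat r t" "Z32 \<in> carrier_mat r r2" "Z33 \<in> carrier_mat r r"
    "Z = sym_block3 Z11 Z21 Z22 Z31 Z32 Z33"
proof -
  obtain Z0 S0 S Z33 where Z0: "Z0 \<in> carrier_mat (t + r2) (t + r2)" "S0 \<in> carrier_mat (t + r2) r"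
    "S \<in> carrier_mat r (t + r2)" "Z33 \<in> carrier_mat r r" and Zeq: "Z = four_block_mat Z0 S0 S Z33"
    using four_block_mat_split[OF Z] by metis
  have "four_block_mat Z0\<^sup>T S\<^sup>T S0\<^sup>T Z33\<^sup>T = four_block_mat Z0 S0 S Z33"
    using sym unfolding Zeq by (subst (asm) transpose_four_block_mat[OF Z0])
  note eqs = four_block_mat_inj[OF this, of "t + r2" "t + r2" r r]
  have Z0sym: "Z0\<^sup>T = Z0" by (rule eqs(1)) (use Z0 in auto)
  have S0: "S0 = S\<^sup>T" by (rule eqs(2)[symmetric]) (use Z0 in auto)
  obtain Z11 Z12 Z21 Z22 where b: "Z11 \<in> carrier_mat t t" "Z12 \<in> carrier_mat t r2"
    "Z21 \<in> carrier_mat r2 t" "Z22 \<in> carrier_mat r2 r2" and Z0eq: "Z0 = four_block_mat Z11 Z12 Z21 Z22"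
    using four_block_mat_split[OF Z0(1)] by metis
  have "four_block_mat Z11\<^sup>T Z21\<^sup>T Z12\<^sup>T Z22\<^sup>T = four_block_mat Z11 Z12 Z21 Z22"
    using Z0sym unfolding Z0eq by (subst (asm) transpose_four_block_mat[OF b])
  note eqs' = four_block_mat_inj[OF this, of t t r2 r2]
  have Z12: "Z12 = Z21\<^sup>T" by (rule eqs'(2)[symmetric]) (use b in auto)
  obtain Z31 Z32 where c: "Z31 \<in> carrier_mat r t" "Z32 \<in> carrier_mat r r2" "S = append_cols Z31 Z32"
    using append_cols_split[OF Z0(3)] by metis
  have "Z = sym_block3 Z11 Z21 Z22 Z31 Z32 Z33"
    unfolding sym_block3_def Zeq Z0eq Z12 S0 c(3) by (simp add: append_cols_transpose)
  then show ?thesis using that b(1,3,4) c(1,2) Z0(4) by blast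
qed

lemma sym_block3_mult_row_selector:
  assumes "Z11 \<in> carrier_mat t t" "Z21 \<in> carrier_mat r2 t" "Z22 \<in> carrier_mat r2 r2"
    "Z31 \<in> carrier_mat r t" "Z32 \<in> carrier_mat r r2" "Z33 \<in> carrier_mat r r"
  shows "sym_block3 Z11 Z21 Z22 Z31 Z32 Z33 \<in> carrier_mat (t + r2 + r) (t + r2 + r)"
    and "sym_block3 Z11 Z21 Z22 Z31 Z32 Z33 * row_selector (t + r2 + r) (t + r2) r
      = (Z31\<^sup>T @\<^sub>r Z32\<^sup>T) @\<^sub>r Z33"
proof -
  let ?Z0 = "four_block_mat Z11 (Z21\<^sup>T) Z21 Z22" and ?S = "Z31\<^sup>T @\<^sub>r Z32\<^sup>T"
  have c: "?Z0 \<in> carrier_mat (t + r2) (t + r2)" "?S \<in> carrier_mat (t + r2) r"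
    "append_cols Z31 Z32 \<in> carrier_mat r (t + r2)"
    using assms by (auto intro!: carrier_matI)
  show "sym_block3 Z11 Z21 Z22 Z31 Z32 Z33 \<in> carrier_mat (t + r2 + r) (t + r2 + r)"
    unfolding sym_block3_def using c assms by auto
  show "sym_block3 Z11 Z21 Z22 Z31 Z32 Z33 * row_selector (t + r2 + r) (t + r2) r = ?S @\<^sub>r Z33"
    unfolding sym_block3_def row_selector_last
    unfolding append_rows_def[of "0\<^sub>m (t + r2) r"] append_rows_def[of ?S Z33]
    by (subst mult_four_block_mat[OF c assms(6), of _ r _ 0]) (use c assms in auto)
qed

text \<open>Serves both descriptions: \<open>T\<close>, \<open>C\<close>, \<open>R\<close> are
  \<open>U\<close>, \<open>\<Sigma>\<close> squared and the inverse of \<open>\<Sigma>\<close> times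
  \<open>V\<^sup>T\<close> in one, and \<open>A\<close> with two identities in the other. The
  condition \<open>T * C * R = A\<close> makes the anchor rows of \<open>P\<close> correct, and
  \<open>h\<close> absorbs the different bracketing of the formula for \<open>X\<close>.\<close>

lemma face_form_eq_face_image:
  fixes A T C R U2 :: "real mat" and h :: "real mat \<Rightarrow> real mat"
  assumes U2: "U2 \<in> carrier_mat k r2" and T: "T \<in> carrier_mat m r" and C: "C \<in> carrier_mat r r"
    and R: "R \<in> carrier_mat r r" and A: "T * C * R = A"
    and h: "\<And>S. S \<in> carrier_mat (t + k) r \<Longrightarrow> h S = S * R"
  shows "{(P, Y). \<exists>Z11 Z21 Z22 Z31 Z32 Z33 Z X.
     Z11 \<in> carrier_mat t t \<and> Z21 \<in> carrier_mat r2 t \<and> Z22 \<in> carrier_mat r2 r2 \<and>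
     Z31 \<in> carrier_mat r t \<and> Z32 \<in> carrier_mat r r2 \<and> Z33 \<in> carrier_mat r r \<and>
     Z = sym_block3 Z11 Z21 Z22 Z31 Z32 Z33 \<and> psd Z \<and>
     Y = diag_block_mat [1\<^sub>m t, U2, T] * Z * (diag_block_mat [1\<^sub>m t, U2, T])\<^sup>T \<and>
     Z33 = C \<and> X = h (Z31\<^sup>T @\<^sub>r (U2 * Z32\<^sup>T)) \<and> P = X @\<^sub>r A}
   = face_image (block_diag (block_diag (1\<^sub>m t) U2) T) (row_selector (t + r2 + r) (t + r2) r) C R"
    (is "?L = face_image ?D ?S C R")
proof -
  note [simp] = carrier_matD[OF U2] carrier_matD[OF T] carrier_matD[OF C] carrier_matD[OF R]
  have D: "diag_block_mat [1\<^sub>m t, U2, T] = ?D"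
    unfolding diag_block_mat_three block_diag_assoc ..
  have Dc: "?D \<in> carrier_mat (t + k + m) (t + r2 + r)" by (auto intro!: carrier_matI)
  have key: "?S\<^sup>T * Z * ?S = Z33"
    "Z33 = C \<Longrightarrow> ?D * Z * ?S * R = h (Z31\<^sup>T @\<^sub>r (U2 * Z32\<^sup>T)) @\<^sub>r A"
    if Z: "Z11 \<in> carrier_mat t t" "Z21 \<in> carrier_mat r2 t" "Z22 \<in> carrier_mat r2 r2"
     "Z31 \<in> carrier_mat r t" "Z32 \<in> carrier_mat r r2" "Z33 \<in> carrier_mat r r"
     "Z = sym_block3 Z11 Z21 Z22 Z31 Z32 Z33" for Z11 Z21 Z22 Z31 Z32 Z33 Z
  proof -
    note [simp] = carrier_matD[OF Z(4)] carrier_matD[OF Z(5)] carrier_matD[OF Z(6)]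
    have Zc: "Z \<in> carrier_mat (t + r2 + r) (t + r2 + r)"
      and ZS: "Z * ?S = (Z31\<^sup>T @\<^sub>r Z32\<^sup>T) @\<^sub>r Z33"
      using sym_block3_mult_row_selector[OF Z(1-6)] Z(7) by auto
    note [simp] = carrier_matD[OF Zc]
    have "?S\<^sup>T * Z * ?S = ?S\<^sup>T * (Z * ?S)" by (simp add: mat_assoc_dim)
    also have "\<dots> = Z33"
      unfolding ZS unfolding row_selector_last by (subst append_rows_transpose_mult) auto
    finally show "?S\<^sup>T * Z * ?S = Z33" .
    assume "Z33 = C"
    have "?D * Z * ?S * R = ?D * (Z * ?S) * R" by (simp add: mat_assoc_dim)
    also have "?D * (Z * ?S) = (Z31\<^sup>T @\<^sub>r (U2 * Z32\<^sup>T)) @\<^sub>r (T * C)"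
      unfolding ZS \<open>Z33 = C\<close> by (simp add: block_diag_mult_append_rows)
    also have "\<dots> * R = ((Z31\<^sup>T @\<^sub>r (U2 * Z32\<^sup>T)) * R) @\<^sub>r A"
      using A by (subst append_rows_mult) auto
    also have "(Z31\<^sup>T @\<^sub>r (U2 * Z32\<^sup>T)) * R = h (Z31\<^sup>T @\<^sub>r (U2 * Z32\<^sup>T))"
      by (rule h[symmetric]) (auto intro!: carrier_matI)
    finally show "?D * Z * ?S * R = h (Z31\<^sup>T @\<^sub>r (U2 * Z32\<^sup>T)) @\<^sub>r A" .
  qed
  show ?thesis
  proof (intro equalityI subrelI)
    fix P Y
    assume "(P, Y) \<in> ?L"
    then obtain Z11 Z21 Z22 Z31 Z32 Z33 Z where
      Z: "Z11 \<in> carrier_mat t t" "Z21 \<in> carrier_mat r2 t" "Z22 \<in> carrier_mat r2 r2"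
       "Z31 \<in> carrier_mat r t" "Z32 \<in> carrier_mat r r2" "Z33 \<in> carrier_mat r r"
       "Z = sym_block3 Z11 Z21 Z22 Z31 Z32 Z33"
        and Z': "psd Z" "Y = ?D * Z * ?D\<^sup>T" "Z33 = C" "P = h (Z31\<^sup>T @\<^sub>r (U2 * Z32\<^sup>T)) @\<^sub>r A"
      unfolding D by blast
    have "Z \<in> carrier_mat (t + r2 + r) (t + r2 + r)"
      using sym_block3_mult_row_selector(1)[OF Z(1-6)] Z(7) by simp
    moreover have "?S\<^sup>T * Z * ?S = C" using key(1)[OF Z] Z'(3) by (rule trans)
    moreover have "P = ?D * Z * ?S * R" using Z'(4) key(2)[OF Z Z'(3), symmetric] by (rule trans)
    ultimately show "(P, Y) \<in> face_image ?D ?S C R"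
      unfolding mem_face_image_iff[OF Dc] using Z'(1,2) by (intro bexI[of _ Z] conjI)
  next
    fix P Y
    assume "(P, Y) \<in> face_image ?D ?S C R"
    then obtain Z where Z: "Z \<in> carrier_mat (t + r2 + r) (t + r2 + r)" "psd Z" "?S\<^sup>T * Z * ?S = C"
      "Y = ?D * Z * ?D\<^sup>T" "P = ?D * Z * ?S * R"
      unfolding mem_face_image_iff[OF Dc] by blast
    have "Z\<^sup>T = Z" using Z(2) psd_iff[OF Z(1)] by blast
    then obtain Z11 Z21 Z22 Z31 Z32 Z33 where
      b: "Z11 \<in> carrier_mat t t" "Z21 \<in> carrier_mat r2 t" "Z22 \<in> carrier_mat r2 r2"
       "Z31 \<in> carrier_mat r t" "Z32 \<in> carrier_mat r r2" "Z33 \<in> carrier_mat r r"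
       "Z = sym_block3 Z11 Z21 Z22 Z31 Z32 Z33"
      by (rule sym_block3_split[OF Z(1)])
    have "Z33 = C" using key(1)[OF b, symmetric] Z(3) by (rule trans)
    have "P = h (Z31\<^sup>T @\<^sub>r (U2 * Z32\<^sup>T)) @\<^sub>r A"
      unfolding Z(5) by (rule key(2)[OF b \<open>Z33 = C\<close>])
    then show "(P, Y) \<in> ?L"
      unfolding D mem_Collect_eq prod.case
      by (insert b Z(2,4) \<open>Z33 = C\<close>, rule_tac exI[of _ Z11], rule_tac exI[of _ Z21],
          rule_tac exI[of _ Z22], rule_tac exI[of _ Z31], rule_tac exI[of _ Z32], rule_tac exI[of _ Z33],
          rule_tac exI[of _ Z], rule_tac exI[of _ "h (Z31\<^sup>T @\<^sub>r (U2 * Z32\<^sup>T))"], intro conjI)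
        (assumption | rule refl)+
  qed
qed

text \<open>The congruence of \<open>Z\<close> by \<open>G\<close> is absorbed into
  \<open>D\<close>. By \<open>GS\<close>, on the selected coordinates \<open>G\<close> acts as
  \<open>K\<close>, so an identity block there becomes \<open>K * K\<^sup>T\<close> and the formula
  for \<open>P\<close> acquires the inverse factor.\<close>

lemma face_image_change_basis:
  assumes D: "D \<in> carrier_mat M N" and S: "S \<in> carrier_mat N r"
    and G: "G \<in> carrier_mat N N" "G' \<in> carrier_mat N N" "G * G' = 1\<^sub>m N"
    and K: "K \<in> carrier_mat r r" "K' \<in> carrier_mat r r" "K * K' = 1\<^sub>m r" "K' * K = 1\<^sub>m r"
    and GS: "G\<^sup>T * S = S * K\<^sup>T" "G'\<^sup>T * S = S * K'\<^sup>T"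
  shows "face_image D S (K * K\<^sup>T) K'\<^sup>T = face_image (D * G) S (1\<^sub>m r) (1\<^sub>m r)"
proof -
  note [simp] = carrier_matD[OF D] carrier_matD[OF S] carrier_matD[OF G(1)] carrier_matD[OF G(2)]
    carrier_matD[OF K(1)] carrier_matD[OF K(2)]
  have SG: "S\<^sup>T * G = K * S\<^sup>T" "S\<^sup>T * G' = K' * S\<^sup>T"
    using arg_cong[OF GS(1), of transpose_mat] arg_cong[OF GS(2), of transpose_mat]
    by (simp_all add: mat_transpose_mult_dim)
  have KKt: "K'\<^sup>T * K\<^sup>T = 1\<^sub>m r" "K\<^sup>T * K'\<^sup>T = 1\<^sub>m r"
    using arg_cong[OF K(3), of transpose_mat] arg_cong[OF K(4), of transpose_mat]
    by (simp_all add: mat_transpose_mult_dim)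
  have GGt: "G'\<^sup>T * G\<^sup>T = 1\<^sub>m N"
    using arg_cong[OF G(3), of transpose_mat] by (simp add: mat_transpose_mult_dim)
  note cancel = SG[THEN mat_mult_left_cong, simplified] GS[THEN mat_mult_left_cong, simplified]
    KKt[THEN mat_mult_left_cong, simplified] GGt[THEN mat_mult_left_cong, simplified]
    G(3)[THEN mat_mult_left_cong, simplified] K(3)[THEN mat_mult_left_cong, simplified]
    K(4)[THEN mat_mult_left_cong, simplified]
  show ?thesis
  proof (intro equalityI subrelI)
    fix P Y
    assume "(P, Y) \<in> face_image D S (K * K\<^sup>T) K'\<^sup>T"
    then obtain Z where Z: "Z \<in> carrier_mat N N" "psd Z" "S\<^sup>T * Z * S = K * K\<^sup>T"
      "Y = D * Z * D\<^sup>T" "P = D * Z * S * K'\<^sup>T"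
      unfolding face_image_def by auto
    note [simp] = carrier_matD[OF Z(1)]
    define Z' where "Z' = G' * Z * G'\<^sup>T"
    have psd: "psd Z'" using psd_congruence[OF Z(2,1), of "G'\<^sup>T" N] G by (simp add: Z'_def)
    have Z'c: "Z' \<in> carrier_mat N N" by (auto simp: Z'_def intro!: carrier_matI)
    have "S\<^sup>T * Z' * S = K' * (S\<^sup>T * Z * S) * K'\<^sup>T"
      by (simp add: Z'_def mat_dim_simps cancel GS SG)
    also have "\<dots> = 1\<^sub>m r" unfolding Z(3) by (simp add: mat_dim_simps cancel K KKt)
    finally have "S\<^sup>T * Z' * S = 1\<^sub>m r" .
    moreover have "Y = (D * G) * Z' * (D * G)\<^sup>T"
      unfolding Z(4) by (simp add: Z'_def mat_dim_simps cancel)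
    moreover have "P = (D * G) * Z' * S * 1\<^sub>m r"
      unfolding Z(5) by (simp add: Z'_def mat_dim_simps cancel GS)
    ultimately show "(P, Y) \<in> face_image (D * G) S (1\<^sub>m r) (1\<^sub>m r)"
      unfolding face_image_def using psd Z'c by auto
  next
    fix P Y
    assume "(P, Y) \<in> face_image (D * G) S (1\<^sub>m r) (1\<^sub>m r)"
    then obtain Z where Z: "Z \<in> carrier_mat N N" "psd Z" "S\<^sup>T * Z * S = 1\<^sub>m r"
      "Y = (D * G) * Z * (D * G)\<^sup>T" "P = (D * G) * Z * S * 1\<^sub>m r"
      unfolding face_image_def by auto
    note [simp] = carrier_matD[OF Z(1)]
    define Z' where "Z' = G * Z * G\<^sup>T"
    have psd: "psd Z'" using psd_congruence[OF Z(2,1), of "G\<^sup>T" N] G by (simp add: Z'_def)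
    have Z'c: "Z' \<in> carrier_mat N N" by (auto simp: Z'_def intro!: carrier_matI)
    have "S\<^sup>T * Z' * S = K * (S\<^sup>T * Z * S) * K\<^sup>T"
      by (simp add: Z'_def mat_dim_simps cancel GS SG)
    then have "S\<^sup>T * Z' * S = K * K\<^sup>T" unfolding Z(3) by simp
    moreover have "Y = D * Z' * D\<^sup>T"
      unfolding Z(4) by (simp add: Z'_def mat_dim_simps)
    moreover have "P = D * Z' * S * K'\<^sup>T"
      unfolding Z(5) by (simp add: Z'_def mat_dim_simps cancel GS KKt)
    ultimately show "(P, Y) \<in> face_image D S (K * K\<^sup>T) K'\<^sup>T"
      unfolding face_image_def using psd Z'c by auto
  qed
qed

text \<open>With an identity anchor block, \<open>P = D * Z * S\<close>, so
  \<open>Y - P * P\<^sup>T\<close> is the congruence by \<open>D\<close> of a Schur complement of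
  \<open>Z\<close>. The hypothesis \<open>DS\<close> says that the anchor rows of \<open>D\<close>
  are \<open>A\<close> in the selected columns and zero elsewhere, which gives the two anchor
  conditions.\<close>

lemma face_image_subset_feasible:
  assumes D: "D \<in> carrier_mat (n + m) N" and A: "A \<in> carrier_mat m r" and S: "S \<in> carrier_mat N r"
    and DS: "(row_selector (n + m) n m)\<^sup>T * D = A * S\<^sup>T"
  shows "face_image D S (1\<^sub>m r) (1\<^sub>m r) \<subseteq> feasible_FG n m r A"
proof (rule subrelI)
  fix P Y assume "(P, Y) \<in> face_image D S (1\<^sub>m r) (1\<^sub>m r)"
  note [simp] = carrier_matD[OF D] carrier_matD[OF S] carrier_matD[OF A]
  then obtain Z where Z: "Z \<in> carrier_mat N N" "psd Z" "S\<^sup>T * Z * S = 1\<^sub>m r"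
    "Y = D * Z * D\<^sup>T" "P = D * Z * S"
    using \<open>(P, Y) \<in> _\<close> unfolding face_image_def by auto
  note [simp] = carrier_matD[OF Z(1)]
  let ?J = "row_selector (n + m) n m"
  have sym: "Z\<^sup>T = Z" using Z psd_iff by blast
  have P: "P \<in> carrier_mat (n + m) r" and Y: "Y \<in> carrier_mat (n + m) (n + m)"
    unfolding Z by (auto intro!: carrier_matI)
  note [simp] = carrier_matD[OF P] carrier_matD[OF Y]
  have DJ: "D\<^sup>T * ?J = S * A\<^sup>T"
    using arg_cong[OF DS, of transpose_mat] by (simp add: mat_transpose_mult_dim)
  have "?J\<^sup>T * Y * ?J = A * (S\<^sup>T * Z * S) * A\<^sup>T"
    unfolding Z(4) using DJ by (simp add: mat_dim_simps DS[THEN mat_mult_left_cong])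
  then have "submatrix Y {n..<n+m} {n..<n+m} = A * A\<^sup>T"
    using submatrix_block_eq[OF Y, of "n + m" n] Z(3) by simp
  moreover have "?J\<^sup>T * P = A * (S\<^sup>T * Z * S)"
    unfolding Z(5) by (simp add: mat_dim_simps DS[THEN mat_mult_left_cong])
  then have "submatrix P {n..<n+m} {0..<r} = A"
    using submatrix_rows_eq[OF P, of "n + m" n] Z(3) by simp
  moreover have "Y\<^sup>T = Y" unfolding Z(4) by (simp add: mat_dim_simps sym)
  moreover have "psd (Y - P * P\<^sup>T)"
  proof -
    have "psd (D\<^sup>T\<^sup>T * (Z - (Z * S) * (Z * S)\<^sup>T) * D\<^sup>T)"
      using psd_schur_complement[OF Z(2,1) S Z(3)] D
      by (intro psd_congruence[of _ N]) (auto intro!: carrier_matI)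
    also have "D\<^sup>T\<^sup>T * (Z - (Z * S) * (Z * S)\<^sup>T) * D\<^sup>T = Y - P * P\<^sup>T"
      unfolding Z by (simp add: mat_dim_simps sym)
    finally show ?thesis .
  qed
  moreover have "0\<^sub>m (n + m) (n + m) - (P * P\<^sup>T - Y) = Y - P * P\<^sup>T"
    by (rule eq_matI) auto
  ultimately show "(P, Y) \<in> feasible_FG n m r A"
    unfolding feasible_FG_def loewner_le_def using P Y by auto
qed

text \<open>The identity is resolved into \<open>?D * ?D\<^sup>T\<close> and two terms annihilated
  by \<open>Y\<close>, one from the clique and one from the anchors. Hence \<open>Y\<close> is
  unchanged by \<open>?D * ?D\<^sup>T\<close> on either side and is recovered from its
  compression.\<close>

lemma feasible_subset_face_image:
  assumes feas: "(P, Y) \<in> feasible_FG (t + k) m r A"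
    and A: "A \<in> carrier_mat m r" and svd: "compact_svd m r A U \<Sigma> V"
    and Si: "Si \<in> carrier_mat r r" "\<Sigma> * Si = 1\<^sub>m r"
    and U2: "U2 \<in> carrier_mat k r2" and W: "W \<in> carrier_mat k s"
    and orth: "U2 * U2\<^sup>T + W * W\<^sup>T = 1\<^sub>m k"
    and zero: "W\<^sup>T * submatrix Y {t..<t + k} {t..<t + k} * W = 0\<^sub>m s s"
  shows "(P, Y) \<in> face_image (block_diag (block_diag (1\<^sub>m t) U2) U)
           (row_selector (t + r2 + r) (t + r2) r) (\<Sigma> * \<Sigma>) (Si * V\<^sup>T)"
    (is "_ \<in> face_image ?D ?S _ _")
proof -
  let ?N = "t + k + m"
  let ?J2 = "row_selector ?N t k" and ?J3 = "row_selector ?N (t + k) m"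
  have U: "U \<in> carrier_mat m r" "U\<^sup>T * U = 1\<^sub>m r" and V: "V \<in> carrier_mat r r" "V\<^sup>T * V = 1\<^sub>m r"
    "V * V\<^sup>T = 1\<^sub>m r" and Sg: "\<Sigma> \<in> carrier_mat r r" "\<Sigma>\<^sup>T = \<Sigma>" and A_eq: "A = U * \<Sigma> * V\<^sup>T"
    using svd by (auto simp: compact_svd_def posdef_def orthogonal_square_def)
  have P: "P \<in> carrier_mat ?N r" and Y: "Y \<in> carrier_mat ?N ?N" and sym: "Y\<^sup>T = Y"
    and psd: "psd (0\<^sub>m ?N ?N - (P * P\<^sup>T - Y))"
    and Y33: "submatrix Y {t + k..<?N} {t + k..<?N} = A * A\<^sup>T"
    and P3: "submatrix P {t + k..<?N} {0..<r} = A"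
    using feas by (auto simp: feasible_FG_def loewner_le_def)
  note [simp] = carrier_matD[OF U(1)] carrier_matD[OF V(1)] carrier_matD[OF Sg(1)] carrier_matD[OF P]
    carrier_matD[OF Y] carrier_matD[OF A] carrier_matD[OF Si(1)] carrier_matD[OF U2] carrier_matD[OF W]
  note cancel = U(2)[THEN mat_mult_left_cong, simplified] V(2)[THEN mat_mult_left_cong, simplified]
    Si(2)[THEN mat_mult_left_cong, simplified]
  have "0\<^sub>m ?N ?N - (P * P\<^sup>T - Y) = Y - P * P\<^sup>T" by (rule eq_matI) auto
  then have psdYP: "psd (Y - P * P\<^sup>T)" using psd by simp
  have YP: "Y - P * P\<^sup>T \<in> carrier_mat ?N ?N" by (auto intro!: carrier_matI)
  have "psd ((Y - P * P\<^sup>T) + P * P\<^sup>T)"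
    by (rule psd_add[OF psdYP psd_gram YP]) (auto intro!: carrier_matI)
  also have "(Y - P * P\<^sup>T) + P * P\<^sup>T = Y" by (rule eq_matI) auto
  finally have psdY: "psd Y" .
  have JYJ: "?J3\<^sup>T * Y * ?J3 = A * A\<^sup>T"
    using submatrix_block_eq[OF Y, of ?N "t + k"] Y33 by simp
  have JP: "?J3\<^sup>T * P = A"
    using submatrix_rows_eq[OF P, of ?N "t + k"] P3 by simp
  have PJ: "P\<^sup>T * ?J3 = A\<^sup>T"
    using arg_cong[OF JP, of transpose_mat] by (simp add: mat_transpose_mult_dim)

  \<comment> \<open>Both terms have anchor block \<open>A * A\<^sup>T\<close>. A zero diagonal block
    of a positive semidefinite matrix forces the whole block column to vanish, so the anchor columns
    of \<open>Y\<close> are those of \<open>P * P\<^sup>T\<close>.\<close>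
  have "?J3\<^sup>T * (Y - P * P\<^sup>T) * ?J3 = ?J3\<^sup>T * Y * ?J3 - (?J3\<^sup>T * P) * (P\<^sup>T * ?J3)"
    by (simp add: mat_dim_simps)
  also have "\<dots> = 0\<^sub>m m m" unfolding JYJ JP PJ by (rule minus_r_inv_mat) auto
  finally have "(Y - P * P\<^sup>T) * ?J3 = 0\<^sub>m ?N m"
    by (rule psd_kernel_mat[OF psdYP YP row_selector_carrier])
  then have "Y * ?J3 - P * A\<^sup>T = 0\<^sub>m ?N m" by (simp add: mat_dim_simps PJ)
  then have YJ3: "Y * ?J3 = P * A\<^sup>T"
    by (rule mat_eq_of_minus_eq_zero) (auto intro!: carrier_matI)

  have "(?J2 * W)\<^sup>T * Y * (?J2 * W) = W\<^sup>T * (?J2\<^sup>T * Y * ?J2) * W" by (simp add: mat_dim_simps)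
  also have "\<dots> = 0\<^sub>m s s" using zero submatrix_block_eq[OF Y, of "t + k" t] by simp
  finally have "Y * (?J2 * W) = 0\<^sub>m ?N s"
    by (intro psd_kernel_mat[OF psdY Y]) (auto intro!: carrier_matI)
  then have YJ2: "Y * (?J2 * (W * X)) = 0\<^sub>m ?N (dim_col X)" if "dim_row X = s" for X
    using that by (metis W YJ3 carrier_matD left_mult_zero_mat' mat_assoc_dim row_selector_dim
        index_mult_mat(2,3) Y)
  \<comment> \<open>The orthogonal projection onto the complement of the range of \<open>U\<close>;
    it is annihilated by \<open>A\<^sup>T\<close>, and therefore
    \<open>Y * ?J3 * K = 0\<close>.\<close>
  define K where "K = 1\<^sub>m m - U * U\<^sup>T"
  have K: "K \<in> carrier_mat m m" by (auto simp: K_def intro!: carrier_matI)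
  note [simp] = carrier_matD[OF K]
  have "A\<^sup>T * K = A\<^sup>T - A\<^sup>T"
    unfolding K_def A_eq by (simp add: mat_dim_simps Sg(2) cancel)
  then have AK: "A\<^sup>T * K = 0\<^sub>m r m" by (simp add: minus_r_inv_mat[OF transpose_carrier_mat[THEN iffD2, OF A]])
  have "?D * ?D\<^sup>T = block_diag (block_diag (1\<^sub>m t) (U2 * U2\<^sup>T)) (U * U\<^sup>T)"
    by (simp add: block_diag_transpose block_diag_mult)
  moreover have "(?J2 * W) * (?J2 * W)\<^sup>T = block_diag (block_diag (0\<^sub>m t t) (W * W\<^sup>T)) (0\<^sub>m m m)"
  proof -
    let ?B = "0\<^sub>m t s @\<^sub>r W" and ?O = "0\<^sub>m m s :: real mat"
    have J2W: "?J2 * W = ?B @\<^sub>r ?O" by (simp add: row_selector_middle append_rows_mult)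
    have B: "?B * ?B\<^sup>T = block_diag (0\<^sub>m t t) (W * W\<^sup>T)"
      by (subst append_rows_mult_transpose) (simp_all add: block_diag_def)
    have "(?J2 * W) * (?J2 * W)\<^sup>T = four_block_mat (?B * ?B\<^sup>T) (?B * ?O\<^sup>T) (?O * ?B\<^sup>T) (?O * ?O\<^sup>T)"
      unfolding J2W by (rule append_rows_mult_transpose) simp_all
    then show ?thesis unfolding B by (simp add: block_diag_def)
  qed
  moreover have "(?J3 * K) * ?J3\<^sup>T = block_diag (block_diag (0\<^sub>m t t) (0\<^sub>m k k)) K"
  proof -
    have J3K: "?J3 * K = 0\<^sub>m (t + k) m @\<^sub>r K" by (simp add: row_selector_last append_rows_mult)
    show ?thesis unfolding J3K unfolding row_selector_last
      by (subst append_rows_mult_transpose) (simp_all add: block_diag_def)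
  qed
  moreover have "U * U\<^sup>T + 0\<^sub>m m m = U * U\<^sup>T"
    by (rule right_add_zero_mat) (auto intro!: carrier_matI)
  moreover have "U * U\<^sup>T + K = 1\<^sub>m m" unfolding K_def by (rule eq_matI) auto
  ultimately have one: "?D * ?D\<^sup>T + (?J2 * W) * (?J2 * W)\<^sup>T + (?J3 * K) * ?J3\<^sup>T = 1\<^sub>m ?N"
    by (simp add: block_diag_add orth block_diag_one block_diag_zero)
  have D: "?D \<in> carrier_mat ?N (t + r2 + r)" by (auto intro!: carrier_matI)
  have "Y = Y * 1\<^sub>m ?N" by simp
  also have "\<dots> = Y * (?D * ?D\<^sup>T) + Y * (?J2 * (W * (?J2 * W)\<^sup>T)) + (Y * ?J3) * (K * ?J3\<^sup>T)"
    unfolding one[symmetric] by (simp add: mat_dim_simps)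
  also have "(Y * ?J3) * (K * ?J3\<^sup>T) = P * ((A\<^sup>T * K) * ?J3\<^sup>T)"
    unfolding YJ3 by (simp add: mat_dim_simps)
  also have "Y * (?D * ?D\<^sup>T) + Y * (?J2 * (W * (?J2 * W)\<^sup>T)) + P * ((A\<^sup>T * K) * ?J3\<^sup>T) = Y * (?D * ?D\<^sup>T)"
    unfolding AK by (subst YJ2) (auto intro!: eq_matI)
  finally have YD: "Y * (?D * ?D\<^sup>T) = Y" ..
  have "(Y * (?D * ?D\<^sup>T))\<^sup>T = Y" unfolding YD by (rule sym)
  then have DY: "(?D * ?D\<^sup>T) * Y = Y" by (simp add: mat_transpose_mult_dim sym)

  define Z where "Z = ?D\<^sup>T * Y * ?D"
  have Z: "Z \<in> carrier_mat (t + r2 + r) (t + r2 + r)" by (auto simp: Z_def intro!: carrier_matI)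
  have psdZ: "psd Z" unfolding Z_def by (rule psd_congruence[OF psdY Y D])
  have DS: "?D * ?S = ?J3 * U"
    by (rule block_diag_mult_row_selector[OF _ U(1)]) (auto intro!: carrier_matI)
  have "?S\<^sup>T * Z * ?S = (?D * ?S)\<^sup>T * Y * (?D * ?S)" by (simp add: Z_def mat_dim_simps)
  also have "\<dots> = U\<^sup>T * (?J3\<^sup>T * Y * ?J3) * U" unfolding DS by (simp add: mat_dim_simps)
  also have "\<dots> = \<Sigma> * \<Sigma>" unfolding JYJ A_eq using U(2) by (simp add: mat_dim_simps Sg(2) cancel)
  finally have SZS: "?S\<^sup>T * Z * ?S = \<Sigma> * \<Sigma>" .
  have DZD: "Y = ?D * Z * ?D\<^sup>T"
  proof -
    have "?D * Z * ?D\<^sup>T = (?D * ?D\<^sup>T) * Y * (?D * ?D\<^sup>T)" by (simp add: Z_def mat_assoc_dim)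
    also have "\<dots> = Y" unfolding DY by (rule YD)
    finally show ?thesis ..
  qed
  \<comment> \<open>\<open>P\<close> is read off from the anchor columns
    \<open>P * A\<^sup>T\<close> of \<open>Y\<close>, because \<open>U * Si * V\<^sup>T\<close> is a
    right inverse of \<open>A\<^sup>T\<close>.\<close>
  have "?D * Z * ?S * (Si * V\<^sup>T) = ((?D * ?D\<^sup>T) * Y) * (?D * ?S) * (Si * V\<^sup>T)"
    by (simp add: Z_def mat_assoc_dim)
  also have "\<dots> = (Y * ?J3) * (U * (Si * V\<^sup>T))" unfolding DY DS by (simp add: mat_assoc_dim)
  also have "\<dots> = P" unfolding YJ3 A_eq using V(3) by (simp add: mat_dim_simps Sg(2) cancel)
  finally have "P = ?D * Z * ?S * (Si * V\<^sup>T)" ..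
  then show ?thesis unfolding mem_face_image_iff[OF D] using Z psdZ SZS DZD by blast
qed

lemma posdef_det_nonzero:
  assumes "posdef M" "M \<in> carrier_mat n n"
  shows "det M \<noteq> 0"
proof
  assume "det M = 0"
  then obtain v where "v \<in> carrier_vec n" "v \<noteq> 0\<^sub>v n" "M *\<^sub>v v = 0\<^sub>v n"
    using det_0_iff_vec_prod_zero[OF assms(2)] by blast
  then show False using assms by (auto simp: posdef_def)
qed

text \<open>The invertible matrix \<open>D\<close>, of size \<open>r2\<close>, equals
  \<open>(U\<^sup>T * F) * (F\<^sup>T * U)\<close> and so has rank at most the number
  \<open>s\<close> of columns of \<open>F\<close>.\<close>

lemma gram_orth_diagonalization_exists:
  fixes F :: "real mat"
  assumes F: "F \<in> carrier_mat k s"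
  obtains r2 U W D where "r2 \<le> s" "orth_diagonalization k r2 (F * F\<^sup>T) U W D"
proof -
  have FF: "F * F\<^sup>T \<in> carrier_mat k k" using F by simp
  obtain r2 U W D where d: "orth_diagonalization k r2 (F * F\<^sup>T) U W D" "det D \<noteq> 0"
    using orth_diagonalization_exists[OF psd_gram FF] by blast
  note o = orth_diagonalizationD[OF d(1)]
  note [simp] = carrier_matD[OF F] carrier_matD[OF o(2)] carrier_matD[OF o(4)]
  have "(U\<^sup>T * F) * (F\<^sup>T * U) = U\<^sup>T * (F * F\<^sup>T) * U" by (simp add: mat_assoc_dim)
  also have "\<dots> = (U\<^sup>T * U) * D * (U\<^sup>T * U)" unfolding o(7) by (simp add: mat_assoc_dim)
  also have "\<dots> = D" using o(5) by simp
  finally have "(U\<^sup>T * F) * (F\<^sup>T * U) = D" .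
  moreover have "vec_space.rank r2 ((U\<^sup>T * F) * (F\<^sup>T * U)) \<le> s"
    by (rule vec_space.rank_mult_le[of _ _ _ _ r2]) (auto intro!: carrier_matI)
  moreover have "vec_space.rank r2 D = r2"
    using vec_space.det_rank_iff[OF o(4)] d(2) by blast
  ultimately show ?thesis using that d(1) by metis
qed

text \<open>A constant extra column \<open>sqrt 2\<close> contributes twice the all-ones matrix.
  This column accounts for the \<open>1\<close> in the bound \<open>r + 1\<close>.\<close>

lemma gram_add_ones_factor:
  fixes C :: "real mat"
  assumes C: "C \<in> carrier_mat k r"
  defines "F \<equiv> append_cols C (mat k 1 (\<lambda>_. sqrt 2))"
  shows "F \<in> carrier_mat k (r + 1)"
    "F * F\<^sup>T = C * C\<^sup>T + 2 \<cdot>\<^sub>m outer_prod (ones_vec k) (ones_vec k)"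
proof -
  note [simp] = carrier_matD[OF C]
  show "F \<in> carrier_mat k (r + 1)" by (auto simp: F_def intro!: carrier_matI)
  have "F * F\<^sup>T = C * C\<^sup>T + mat k 1 (\<lambda>_. sqrt 2) * (mat k 1 (\<lambda>_. sqrt 2))\<^sup>T"
    by (simp add: F_def append_cols_transpose append_cols_mult_append_rows)
  also have "mat k 1 (\<lambda>_. sqrt 2) * (mat k 1 (\<lambda>_. sqrt 2))\<^sup>T
      = 2 \<cdot>\<^sub>m outer_prod (ones_vec k) (ones_vec k)"
    by (rule eq_matI) (auto simp: scalar_prod_def)
  finally show "F * F\<^sup>T = C * C\<^sup>T + 2 \<cdot>\<^sub>m outer_prod (ones_vec k) (ones_vec k)" .
qed

text \<open>A kernel vector of a Gram matrix is orthogonal to every column of its factor: to those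
  of \<open>C\<close>, and to the constant column, so that centering fixes it.\<close>

lemma gram_add_ones_kernel:
  fixes C W :: "real mat"
  assumes C: "C \<in> carrier_mat k r" and W: "W \<in> carrier_mat k s"
    and zero: "(C * C\<^sup>T + 2 \<cdot>\<^sub>m outer_prod (ones_vec k) (ones_vec k)) * W = 0\<^sub>m k s"
  shows "C\<^sup>T * W = 0\<^sub>m r s" "centering k * W = W"
proof -
  note [simp] = carrier_matD[OF C] carrier_matD[OF W]
  let ?E = "mat k 1 (\<lambda>_. sqrt 2) :: real mat"
  note F = gram_add_ones_factor[OF C]
  have "(append_cols C ?E)\<^sup>T * W = 0\<^sub>m (r + 1) s"
    using gram_kernel[OF F(1) W] zero unfolding F(2) by simp
  then have "(C\<^sup>T * W) @\<^sub>r (?E\<^sup>T * W) = 0\<^sub>m r s @\<^sub>r 0\<^sub>m 1 s"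
    by (simp add: append_cols_transpose append_rows_mult) (simp add: append_rows_def)
  note eqs = append_rows_inj[OF this]
  show "C\<^sup>T * W = 0\<^sub>m r s" by (rule eqs) auto
  have EW: "?E\<^sup>T * W = 0\<^sub>m 1 s" by (rule eqs) auto
  have "outer_prod (ones_vec k) (ones_vec k) = (1 / 2) \<cdot>\<^sub>m (?E * ?E\<^sup>T)"
    by (rule eq_matI) (auto simp: scalar_prod_def)
  then have "centering k * W = W - (1 / real k) \<cdot>\<^sub>m ((1 / 2) \<cdot>\<^sub>m (?E * (?E\<^sup>T * W)))"
    unfolding centering_def by (simp add: mat_dim_simps)
  also have "\<dots> = W" unfolding EW by (auto intro!: eq_matI)
  finally show "centering k * W = W" .
qed

lemma submatrix_edm_K:
  assumes "Y \<in> carrier_mat N N" "b \<le> N"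
  shows "submatrix (edm_K Y) {a..<b} {a..<b} = edm_K (submatrix Y {a..<b} {a..<b})"
proof -
  have "edm_K Y \<in> carrier_mat N N" using assms by (auto intro!: carrier_matI)
  note sub = submatrix_interval[OF this assms(2,2)] submatrix_interval[OF assms(1,2,2)]
  show ?thesis
    unfolding sub using assms
    by (intro eq_matI) (auto simp: edm_K_index[OF assms(1)] edm_K_index[of _ "b - a"])
qed

lemma submatrix_edm_K_clique:
  assumes Y: "Y \<in> carrier_mat N N" and Y': "Y' \<in> carrier_mat N N" and b: "b \<le> N"
    and clique: "clique {a..<b} edges" and match: "(P, Y) \<in> match_known_distances edges (edm_K Y')"
  shows "submatrix (edm_K Y) {a..<b} {a..<b} = submatrix (edm_K Y') {a..<b} {a..<b}"
proof -
  have "edm_K Y \<in> carrier_mat N N" "edm_K Y' \<in> carrier_mat N N"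
    using Y Y' by (auto intro!: carrier_matI)
  note sub = submatrix_interval[OF this(1) b b] submatrix_interval[OF this(2) b b]
  have "edm_K Y $$ (a + i, a + j) = edm_K Y' $$ (a + i, a + j)" if "i < b - a" "j < b - a" for i j
  proof (cases "i = j")
    \<comment> \<open>A clique supplies edges between distinct nodes only; on the diagonal both
      distance matrices are zero.\<close>
    case True
    then show ?thesis using that b Y Y' by (simp add: edm_K_index[OF Y] edm_K_index[OF Y'])
  next
    case False
    then have "{a + i, a + j} \<in> edges" using clique that by (auto simp: clique_def)
    then show ?thesis using match by (simp add: match_known_distances_def)
  qed
  then show ?thesis unfolding sub by (intro eq_matI) auto
qed

theorem lemma4p3:
  fixes n m r t :: nat
    and A U \<Sigma> V P1 P2 P Ybar E E2 B Bhat :: "real mat"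
    and edges :: "nat set set"
  assumes "m > r" and "n > m"
    and "A \<in> carrier_mat m r"
    and "A\<^sup>T *\<^sub>v ones_vec m = 0\<^sub>v r"
    and "vec_space.rank m A = r"
    and "compact_svd m r A U \<Sigma> V"
    and "t < n"
    and "P1 \<in> carrier_mat t r"
    and "P2 \<in> carrier_mat (n - t) r"
    and "P = (P1 @\<^sub>r P2) @\<^sub>r A"
    and "Ybar = P * P\<^sup>T"
    and "E = edm_K Ybar"
    and "edges \<subseteq> nsets {0..<n+m} 2"
    and "clique {n..<n+m} edges"
    and "clique {t..<n} edges"
    and "E2 = submatrix E {t..<n} {t..<n}"
    and "B = edm_K_pinv E2"
    and "Bhat = B + 2 \<cdot>\<^sub>m outer_prod (ones_vec (n - t)) (ones_vec (n - t))"
  shows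
    "B *\<^sub>v ones_vec (n - t) = 0\<^sub>v (n - t) \<and>
     (\<exists>y2 w \<alpha>. w \<in> vec_space.col_space (n - t) B \<and> 0 \<le> \<alpha> \<and>
        y2 = w + \<alpha> \<cdot>\<^sub>v ones_vec (n - t) \<and>
        submatrix Ybar {t..<n} {t..<n} =
          B + outer_prod y2 (ones_vec (n - t)) + outer_prod (ones_vec (n - t)) y2) \<and>
     psd (submatrix Ybar {t..<n} {t..<n}) \<and>
     vec_space.rank (n - t) (submatrix Ybar {t..<n} {t..<n}) \<le> r \<and>
     (\<exists>r2 U2 Ubar2 D2. r2 \<le> r + 1 \<and> orth_diagonalization (n - t) r2 Bhat U2 Ubar2 D2) \<and>
     (\<forall>r2 U2 Ubar2 D2.
        r2 \<le> r + 1 \<and> orth_diagonalization (n - t) r2 Bhat U2 Ubar2 D2 \<longrightarrow>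
          feasible_FG n m r A \<inter> match_known_distances edges E
            = face_form_U t r2 r U2 A U \<Sigma> V \<inter> match_known_distances edges E \<and>
          feasible_FG n m r A \<inter> match_known_distances edges E
            = face_form_A t r2 r U2 A \<inter> match_known_distances edges E \<and>
          face_form_U t r2 r U2 A U \<Sigma> V = face_form_A t r2 r U2 A \<and>
          face_form_U t r2 r U2 A U \<Sigma> V \<subseteq> feasible_FG n m r A)"
proof -
  note A = assms(3) and svd = assms(6) and P1 = assms(8)
  \<comment> \<open>The number of sensors in the clique; it is positive because
    \<open>t < n\<close>, so dividing by \<open>k\<close> is legitimate.\<close>
  define k where "k = n - t"
  have n: "n = t + k" and k: "k > 0" using assms(7) by (auto simp: k_def)
  have P2: "P2 \<in> carrier_mat k r" using assms(9) by (simp add: k_def)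
  let ?e = "ones_vec k" and ?J = "centering k" and ?M = "match_known_distances edges E"
  have P: "P \<in> carrier_mat (n + m) r" unfolding assms(10) n using P1 P2 A by auto
  have Ybar: "Ybar \<in> carrier_mat (n + m) (n + m)" unfolding assms(11) using P by simp
  note [simp] = carrier_matD[OF A] carrier_matD[OF P1] carrier_matD[OF P2] carrier_matD[OF P]
  define G where "G = P2 * P2\<^sup>T"
  have G: "G \<in> carrier_mat k k" "G\<^sup>T = G" by (auto simp: G_def mat_dim_simps intro!: carrier_matI)
  have G_block: "submatrix Ybar {t..<n} {t..<n} = G"
  proof -
    let ?R = "row_selector (n + m) t k"
    have "?R\<^sup>T * P = P2"
      using row_selector_transpose_mult[OF P, of t k] n P2
      by (auto simp: assms(10) append_rows_def intro!: eq_matI)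
    moreover have "submatrix Ybar {t..<n} {t..<n} = (?R\<^sup>T * P) * (?R\<^sup>T * P)\<^sup>T"
      using submatrix_block_eq[OF Ybar, of n t] n
      by (simp add: assms(11) mat_dim_simps)
    ultimately show ?thesis by (simp add: G_def)
  qed
  define C where "C = ?J * P2"
  have C: "C \<in> carrier_mat k r" by (auto simp: C_def intro!: carrier_matI)
  have E2: "E2 = edm_K G"
    unfolding assms(16,12) G_block[symmetric] using Ybar by (intro submatrix_edm_K) auto
  have B_centered: "B = ?J * G * ?J" unfolding assms(17) E2 by (rule centering_edm_K[OF G(1)])
  have B: "B = C * C\<^sup>T" unfolding B_centered by (simp add: C_def G_def mat_dim_simps)
  have Bhat: "Bhat = C * C\<^sup>T + 2 \<cdot>\<^sub>m outer_prod ?e ?e" unfolding assms(18) B k_def ..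

  have Be: "B *\<^sub>v ?e = 0\<^sub>v k"
  proof -
    have "B *\<^sub>v ?e = (?J * G) *\<^sub>v (?J *\<^sub>v ?e)"
      unfolding B_centered using G by (subst assoc_mult_mat_vec[of _ k k _ k]) auto
    then show ?thesis unfolding centering_ones using G
      by (auto intro!: eq_vecI scalar_prod_right_zero carrier_vecI)
  qed

  \<comment> \<open>\<open>g\<close> is the vector of row means of the clique's Gram matrix;
    \<open>w\<close> and \<open>\<alpha>\<close> are the two parts of the vector in
    \<open>double_centering\<close>.\<close>
  define g where "g = (1 / k) \<cdot>\<^sub>v (G *\<^sub>v ?e)"
  define w where "w = ?J *\<^sub>v g"
  define \<alpha> where "\<alpha> = 1 / (2 * real k) * (?e \<bullet> g)"
  have split: "submatrix Ybar {t..<n} {t..<n}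
      = B + outer_prod (w + \<alpha> \<cdot>\<^sub>v ?e) ?e + outer_prod ?e (w + \<alpha> \<cdot>\<^sub>v ?e)"
    unfolding G_block B_centered w_def \<alpha>_def g_def by (rule double_centering[OF G k])
  have psdG: "psd G" unfolding G_def by (rule psd_gram)
  \<comment> \<open>Up to the positive factor \<open>1 / (2 * k^2)\<close>, \<open>\<alpha>\<close>
    is the quadratic form of \<open>G\<close> at the vector of ones.\<close>
  have \<alpha>: "0 \<le> \<alpha>"
  proof -
    have "0 \<le> ?e \<bullet> (G *\<^sub>v ?e)" using psdG psd_iff[OF G(1)] by auto
    then show ?thesis using G by (simp add: \<alpha>_def g_def)
  qed
  \<comment> \<open>The vector \<open>w\<close> is \<open>C\<close> applied to the mean of the rows
    of \<open>P2\<close>, and the range of \<open>C\<close> lies in that of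
    \<open>C * C\<^sup>T\<close>.\<close>
  have w: "w \<in> vec_space.col_space k B"
  proof -
    have "G *\<^sub>v ?e = P2 *\<^sub>v (P2\<^sup>T *\<^sub>v ?e)"
      unfolding G_def using P2 by (intro assoc_mult_mat_vec[of _ k r _ k]) auto
    then have "g = P2 *\<^sub>v ((1 / k) \<cdot>\<^sub>v (P2\<^sup>T *\<^sub>v ?e))"
      unfolding g_def using P2 by (subst mult_mat_vec[of _ k r]) auto
    then have "w = C *\<^sub>v ((1 / k) \<cdot>\<^sub>v (P2\<^sup>T *\<^sub>v ?e))"
      unfolding w_def C_def using P2 by (subst assoc_mult_mat_vec[of _ k k _ r]) auto
    then show ?thesis unfolding B using gram_col_space[OF C] P2 by simp
  qed
  have rank: "vec_space.rank k G \<le> r"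
    unfolding G_def using P2 by (intro vec_space.rank_mult_le[of _ _ _ _ k]) auto

  have diag: "\<exists>r2 U2 Ubar2 D2. r2 \<le> r + 1 \<and> orth_diagonalization k r2 Bhat U2 Ubar2 D2"
    unfolding Bhat gram_add_ones_factor(2)[OF C, symmetric]
    by (rule gram_orth_diagonalization_exists[OF gram_add_ones_factor(1)[OF C]]) blast

  have U: "U \<in> carrier_mat m r" and V: "V \<in> carrier_mat r r" "V\<^sup>T * V = 1\<^sub>m r" "V * V\<^sup>T = 1\<^sub>m r"
    and Sg: "\<Sigma> \<in> carrier_mat r r" "\<Sigma>\<^sup>T = \<Sigma>" "posdef \<Sigma>" and A_eq: "A = U * \<Sigma> * V\<^sup>T"
    using svd by (auto simp: compact_svd_def posdef_def orthogonal_square_def)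
  obtain Si where Si: "mat_inverse \<Sigma> = Some Si" "Si \<in> carrier_mat r r" "\<Sigma> * Si = 1\<^sub>m r" "Si * \<Sigma> = 1\<^sub>m r"
    using matrix_inverse_obtain[OF Sg(1) posdef_det_nonzero[OF Sg(3,1)]] by blast
  note [simp] = carrier_matD[OF U] carrier_matD[OF V(1)] carrier_matD[OF Sg(1)] carrier_matD[OF Si(2)]
  note cancel = V(2)[THEN mat_mult_left_cong, simplified] V(3)[THEN mat_mult_left_cong, simplified]
    Si(3)[THEN mat_mult_left_cong, simplified] Si(4)[THEN mat_mult_left_cong, simplified]

  have faces: "feasible_FG n m r A \<inter> ?M = face_form_U t r2 r U2 A U \<Sigma> V \<inter> ?M \<and>
      feasible_FG n m r A \<inter> ?M = face_form_A t r2 r U2 A \<inter> ?M \<and>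
      face_form_U t r2 r U2 A U \<Sigma> V = face_form_A t r2 r U2 A \<and>
      face_form_U t r2 r U2 A U \<Sigma> V \<subseteq> feasible_FG n m r A"
    if orth: "orth_diagonalization k r2 Bhat U2 W D2" for r2 U2 W D2
  proof -
    note o = orth_diagonalizationD[OF orth]
    note [simp] = carrier_matD[OF o(2)] carrier_matD[OF o(3)]
    let ?S = "row_selector (t + r2 + r) (t + r2) r"
    let ?D1 = "block_diag (1\<^sub>m t) U2"
    have Sg2: "\<Sigma> ^\<^sub>m 2 = \<Sigma> * \<Sigma>" by (simp add: numeral_2_eq_2)
    have faceU: "face_form_U t r2 r U2 A U \<Sigma> V = face_image (block_diag ?D1 U) ?S (\<Sigma> * \<Sigma>) (Si * V\<^sup>T)"
      unfolding face_form_U_def Si(1) option.sel Sg2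
      by (rule face_form_eq_face_image[OF o(2) U, where h = "\<lambda>S. S * Si * V\<^sup>T"])
        (auto simp: mat_dim_simps cancel A_eq intro!: carrier_matI)
    have faceA: "face_form_A t r2 r U2 A = face_image (block_diag ?D1 A) ?S (1\<^sub>m r) (1\<^sub>m r)"
      unfolding face_form_A_def
      by (rule face_form_eq_face_image[OF o(2) A, where h = "\<lambda>S. S"]) auto
    \<comment> \<open>Since \<open>A = U * ?K\<close>, replacing \<open>U\<close> by
      \<open>A\<close> is a change of basis in the anchor coordinates alone.\<close>
    let ?I = "1\<^sub>m (t + r2) :: real mat" and ?K = "\<Sigma> * V\<^sup>T" and ?K' = "V * Si"
    have KK: "?K * ?K' = 1\<^sub>m r" "?K' * ?K = 1\<^sub>m r"
      using V Si by (simp_all add: mat_dim_simps cancel)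
    have Sit: "Si\<^sup>T = Si"
    proof -
      have "\<Sigma> * Si\<^sup>T = 1\<^sub>m r"
        using arg_cong[OF Si(4), of transpose_mat] by (simp add: mat_transpose_mult_dim Sg(2))
      then have "Si * (\<Sigma> * Si\<^sup>T) = Si" by simp
      then show ?thesis by (simp add: cancel)
    qed
    have "face_image (block_diag ?D1 U) ?S (?K * ?K\<^sup>T) ?K'\<^sup>T
        = face_image (block_diag ?D1 U * block_diag ?I ?K) ?S (1\<^sub>m r) (1\<^sub>m r)"
    proof (rule face_image_change_basis)
      show "block_diag ?I ?K * block_diag ?I ?K' = 1\<^sub>m (t + r2 + r)"
        using KK by (simp add: block_diag_mult block_diag_one)
      show "(block_diag ?I ?K)\<^sup>T * ?S = ?S * ?K\<^sup>T" "(block_diag ?I ?K')\<^sup>T * ?S = ?S * ?K'\<^sup>T"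
        by (simp_all add: block_diag_transpose row_selector_last block_diag_mult_append_rows append_rows_mult)
    qed (use KK in \<open>auto intro!: carrier_matI\<close>)
    moreover have "?K * ?K\<^sup>T = \<Sigma> * \<Sigma>" by (simp add: mat_dim_simps cancel Sg(2))
    moreover have "?K'\<^sup>T = Si * V\<^sup>T" by (simp add: mat_dim_simps Sit)
    moreover have "block_diag ?D1 U * block_diag ?I ?K = block_diag ?D1 A"
      by (simp add: block_diag_mult A_eq mat_assoc_dim)
    ultimately have UA: "face_form_U t r2 r U2 A U \<Sigma> V = face_form_A t r2 r U2 A"
      unfolding faceU faceA by simp
    \<comment> \<open>Feasibility is checked in the form with \<open>A\<close>, whose anchor block
      is the identity; \<open>UA\<close> transfers it to the other form.\<close>
    have sub: "face_form_A t r2 r U2 A \<subseteq> feasible_FG n m r A"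
      unfolding faceA
    proof (rule face_image_subset_feasible)
      show "block_diag ?D1 A \<in> carrier_mat (n + m) (t + r2 + r)"
        by (auto simp: n intro!: carrier_matI)
      have "block_diag ?D1\<^sup>T A\<^sup>T * row_selector (n + m) n m = ?S * A\<^sup>T"
        by (simp add: row_selector_last block_diag_mult_append_rows append_rows_mult n)
      from arg_cong[OF this, of transpose_mat]
      show "(row_selector (n + m) n m)\<^sup>T * block_diag ?D1 A = A * ?S\<^sup>T"
        by (simp add: mat_transpose_mult_dim block_diag_transpose n)
    qed (auto intro: A)
    have CW: "C\<^sup>T * W = 0\<^sub>m r (k - r2)" and JW: "?J * W = W"
      using gram_add_ones_kernel[OF C o(3)] o(8) unfolding Bhat by simp_all
    have "feasible_FG n m r A \<inter> ?M \<subseteq> face_form_U t r2 r U2 A U \<Sigma> V"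
    proof (rule subrelI)
      fix Q Y assume QY: "(Q, Y) \<in> feasible_FG n m r A \<inter> ?M"
      then have Y: "Y \<in> carrier_mat (n + m) (n + m)" by (auto simp: feasible_FG_def)
      define H where "H = submatrix Y {t..<n} {t..<n}"
      have H: "H \<in> carrier_mat k k"
        unfolding H_def by (subst submatrix_interval[OF Y]) (auto simp: n)
      note [simp] = carrier_matD[OF H]
      \<comment> \<open>Matching the distances in the clique determines \<open>edm_K H\<close>,
        hence its double centering \<open>B\<close>. As centering fixes \<open>W\<close>, the
        matrices \<open>H\<close> and \<open>B\<close> have the same compression by
        \<open>W\<close>, namely zero.\<close>
      have "edm_K H = E2"
        unfolding H_def assms(16,12)
        using submatrix_edm_K[OF Y, of n t]
          submatrix_edm_K_clique[OF Y Ybar, of n t edges Q] QY assms(12,15) by auto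
      then have "?J * H * ?J = B" unfolding assms(17) using centering_edm_K[OF H] by simp
      moreover have "W\<^sup>T * (?J * H * ?J) * W = (?J * W)\<^sup>T * H * (?J * W)"
        by (simp add: mat_dim_simps)
      ultimately have "W\<^sup>T * B * W = (?J * W)\<^sup>T * H * (?J * W)" by (simp only:)
      moreover have "W\<^sup>T * B * W = 0\<^sub>m (k - r2) (k - r2)"
        unfolding B using C CW by (simp add: mat_dim_simps)
      ultimately have "W\<^sup>T * H * W = 0\<^sub>m (k - r2) (k - r2)" unfolding JW by simp
      then show "(Q, Y) \<in> face_form_U t r2 r U2 A U \<Sigma> V"
        unfolding faceU using QY
        by (intro feasible_subset_face_image[OF _ A svd Si(2,3) o(2,3,6)])
          (auto simp: n H_def)
    qed
    \<comment> \<open>The inclusion just proved and \<open>sub\<close> are the two directions of the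
      equalities under the distance constraint.\<close>
    then show ?thesis using UA sub by auto
  qed
  show ?thesis
    unfolding k_def[symmetric]
    using Be w \<alpha> split psdG rank diag faces unfolding G_block by blast
qed

end
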